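(* Let $(\nu,\nu')$ be a regular couple of characters of $(\mathcal O_r^E)^\times$ and let $\mathcal C_{\nu,\nu'}$ be the associated cuspidal representation of $GL(2,\mathcal O_r)$. For every $0\le i\le r-1$, $\alpha\in\mathcal O_r^\times$ and $\beta\in\mathcal O_r$, the character of $\mathcal C_{\nu,\nu'}$ at $B_{i,\alpha,\beta}=\begin{pmatrix}\alpha&\varpi^{i+1}\beta\\ \varpi^i&\alpha\end{pmatrix}$ is $$\mathrm{tr}(B_{i,\alpha,\beta}|_{\mathcal C_{\nu,\nu'}})=-\delta_{i,r-1}\,\nu(\alpha)\nu'(\alpha)\,q^{r-1},$$ where $\delta_{i,r-1}$ is the Kronecker symbol.
   Context: $F$ is a non-archimedean local field with ring of integers $\mathcal O$, uniformizer $\varpi$, residue field of cardinality $q$ and characteristic $p\neq2$. $r\ge2$ is an even integer, $l=r/2$, $\mathcal O_r=\mathcal O/\varpi^r\mathcal O$, $G^{(r)}=GL(2,\mathcal O_r)$, $K_l=\{g\in G^{(r)}: g\equiv I \bmod \varpi^l\}$. $\psi:(\mathcal O,+)\to\mathbb C^\times$ is a fixed smooth additive character of level $r$ (trivial on $\varpi^r\mathcal O$ but not on $\varpi^{r-1}\mathcal O$), viewed as a character of $\mathcal O_r$. $E$ is the unramified quadratic extension of $F$, $\sigma$ the nontrivial element of $\mathrm{Gal}(E/F)$, $\mathcal O^E$ the ring of integers of $E$, $\mathcal O^E_k=\mathcal O^E/\varpi^k\mathcal O^E$; $Tr(x)=x+\sigma(x)$, $N(x)=x\sigma(x)$. Put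 $\mathcal O_r^{E(-)}=\{z\in\mathcal O_r^E:\sigma(z)=-z\}$. A couple $(\nu,\nu')$ of characters $(\mathcal O_r^E)^\times\to\mathbb C^\times$ is regular if the restriction of $\nu\nu'^{-1}$ to the group $1+\varpi^l\mathcal O_r^{E(-)}$ is of level $l$, i.e. nontrivial on $1+\varpi^{r-1}\mathcal O_r^{E(-)}$. To a regular couple is associated the unique $\tau\in\mathcal O_l^E$ such that $\nu(1+\varpi^lz)\,\nu'(1+\varpi^l\sigma(z))=\psi\big(\varpi^l(\tau z+\sigma(\tau)\sigma(z))\big)$ for all $z\in\mathcal O_r^E$; one has $\tau-\sigma(\tau)\not\equiv0$ mod $\varpi$. Let $\hat\tau\in\mathcal O_r^E$ be any lift of $\tau$, $\hat\beta=\begin{pmatrix}0&1\\-N(\hat\tau)&Tr(\hat\tau)\end{pmatrix}$, $S=\mathcal O_r[\hat\beta]^\times=\{aI+b\hat\beta: a,b\in\mathcal O_r\}\cap G^{(r)}$, $T=SK_l$. Then $\nu\boxtimes\nu'$ is the one-dimensional representation of $T$ defined by $(\nu\boxtimes\nu')(sk)=\nu(a+b\hat\tau)\,\nu'(a+b\sigma(\hat\tau))\,\psi(\mathrm{Tr}(\hat\beta(k-I)))$ for $s=aI+b\hat\beta\in S$, $k\in K_l$ (Tr being here the matrix trace), and $\mathcal C_{\nu,\nu'}=\mathrm{Ind}_T^{G^{(r)}}(\nu\boxtimes\nu')$. In $\nu(\alpha)$, $\nu'(\alpha)$, $\alpha\in\mathcal O_r^\times$ is viewed in $(\mathcal O_r^E)^\times$.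 *)

theory Defs
  imports "HOL-Analysis.Analysis" "HOL-Library.Function_Algebras" "HOL-Library.Numeral_Type"
begin

text \<open>
  Non-archimedean local fields, as fields that are complete with respect to a normalised discrete
  valuation and have a finite residue field.  The valuation takes values in the integers and is
  meaningful on nonzero arguments only; \<open>val_ge k x\<close> says that the valuation of
  \<open>x\<close> is at least \<open>k\<close>, where 0 has infinite valuation.
\<close>

class discrete_valued_field = field +
  fixes val :: "'a \<Rightarrow> int"
  assumes val_mult: "x \<noteq> 0 \<Longrightarrow> y \<noteq> 0 \<Longrightarrow> val (x * y) = val x + val y"
    and val_add: "x \<noteq> 0 \<Longrightarrow> y \<noteq> 0 \<Longrightarrow> x + y \<noteq> 0 \<Longrightarrow> min (val x) (val y) \<le> val (x + y)"
    and val_normalised: "\<exists>x. x \<noteq> 0 \<and> val x = 1"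
begin

definition val_ge :: "int \<Rightarrow> 'a \<Rightarrow> bool"
  where "val_ge k x \<longleftrightarrow> x = 0 \<or> k \<le> val x"

definition integers :: "'a set"
  where "integers = {x. val_ge 0 x}"

definition val_cong :: "nat \<Rightarrow> 'a \<Rightarrow> 'a \<Rightarrow> bool"
  where "val_cong n x y \<longleftrightarrow> x \<in> integers \<and> y \<in> integers \<and> val_ge (int n) (x - y)"

definition val_Cauchy :: "(nat \<Rightarrow> 'a) \<Rightarrow> bool"
  where "val_Cauchy s \<longleftrightarrow> (\<forall>k. \<exists>M. \<forall>m\<ge>M. \<forall>n\<ge>M. val_ge k (s m - s n))"

definition val_tendsto :: "(nat \<Rightarrow> 'a) \<Rightarrow> 'a \<Rightarrow> bool"
  where "val_tendsto s L \<longleftrightarrow> (\<forall>k. \<exists>M. \<forall>n\<ge>M. val_ge k (s n - L))"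

end

class nonarch_local_field = discrete_valued_field +
  assumes val_complete: "val_Cauchy s \<Longrightarrow> \<exists>L. val_tendsto s L"
    and finite_residue_field: "finite (integers // {(x, y). val_cong 1 x y})"

context discrete_valued_field
begin

lemma val_one [simp]: "val 1 = 0"
  using val_mult[of 1 1] by simp

lemma val_minus_one [simp]: "val (- 1) = 0"
  using val_mult[of "- 1" "- 1"] by simp

lemma val_uminus [simp]: "val (- x) = val x"
proof (cases "x = 0")
  case False
  then show ?thesis using val_mult[of "- 1" x] by simp
qed simp

lemma val_ge_0 [simp]: "val_ge k 0"
  by (simp add: val_ge_def)

lemma val_ge_one [simp]: "val_ge k 1 \<longleftrightarrow> k \<le> 0"
  by (simp add: val_ge_def)

lemma val_ge_uminus [simp]: "val_ge k (- x) \<longleftrightarrow> val_ge k x"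
  by (simp add: val_ge_def)

lemma val_ge_add: "val_ge k x \<Longrightarrow> val_ge k y \<Longrightarrow> val_ge k (x + y)"
  using val_add[of x y] by (cases "x = 0"; cases "y = 0"; cases "x + y = 0") (auto simp: val_ge_def)

lemma val_ge_diff: "val_ge k x \<Longrightarrow> val_ge k y \<Longrightarrow> val_ge k (x - y)"
  using val_ge_add[of k x "- y"] by simp

lemma val_ge_mult: "val_ge k x \<Longrightarrow> val_ge m y \<Longrightarrow> val_ge (k + m) (x * y)"
  by (cases "x = 0"; cases "y = 0") (auto simp: val_ge_def val_mult)

lemma val_cong_part_equivp: "part_equivp (val_cong n)"
proof (rule part_equivpI)
  show "\<exists>x. val_cong n x x"
    by (rule exI[of _ 0]) (simp add: val_cong_def integers_def)
  show "symp (val_cong n)"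
  proof (rule sympI)
    fix x y assume "val_cong n x y"
    then show "val_cong n y x"
      using val_ge_uminus[of "int n" "x - y"] by (simp add: val_cong_def)
  qed
  show "transp (val_cong n)"
  proof (rule transpI)
    fix x y z assume "val_cong n x y" "val_cong n y z"
    then show "val_cong n x z"
      using val_ge_add[of "int n" "x - y" "y - z"] by (simp add: val_cong_def algebra_simps)
  qed
qed

end


text \<open>
  The ring \<open>('a, 'n) trunc\<close> is the quotient of the ring of integers of \<open>'a\<close> by
  the \<open>n\<close>-th power of its maximal ideal, where \<open>n = CARD('n)\<close>.  In particular,
  \<open>('a, 1) trunc\<close> is the residue field.  The maps \<open>abs_trunc\<close> (meaningful on
  integers only) and \<open>rep_trunc\<close> (an arbitrary representative) relate it to \<open>'a\<close>.
\<close>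

typedef (overloaded) ('a, 'n) trunc =
  "(integers :: 'a::discrete_valued_field set) // {(x, y). val_cong CARD('n::finite) x y}"
  morphisms coset_of_trunc trunc_of_coset
proof -
  have "(0::'a) \<in> integers"
    by (simp add: integers_def)
  then show ?thesis
    by (metis quotientI)
qed

definition abs_trunc :: "'a::discrete_valued_field \<Rightarrow> ('a, 'n::finite) trunc"
  where "abs_trunc x = trunc_of_coset ({(x, y). val_cong CARD('n) x y} `` {x})"

definition rep_trunc :: "('a::discrete_valued_field, 'n::finite) trunc \<Rightarrow> 'a"
  where "rep_trunc a = (SOME x. x \<in> coset_of_trunc a)"

definition cr_trunc :: "'a::discrete_valued_field \<Rightarrow> ('a, 'n::finite) trunc \<Rightarrow> bool"
  where "cr_trunc x a \<longleftrightarrow> val_cong CARD('n) x x \<and> abs_trunc x = a"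

lemma Quotient_trunc:
  "Quotient (val_cong CARD('n)) abs_trunc rep_trunc
    (cr_trunc :: 'a::discrete_valued_field \<Rightarrow> ('a, 'n::finite) trunc \<Rightarrow> bool)"
proof -
  let ?R = "val_cong CARD('n) :: 'a \<Rightarrow> 'a \<Rightarrow> bool"
  let ?S = "{(x, y). ?R x y}"
  have symR: "?R y x" if "?R x y" for x y
    using val_cong_part_equivp that by (metis part_equivp_symp)
  have transR: "?R x z" if "?R x y" "?R y z" for x y z
    using val_cong_part_equivp that by (metis part_equivp_transp)
  have R_refl: "?R x x \<longleftrightarrow> x \<in> integers" for x
    by (simp add: val_cong_def)
  have coset: "coset_of_trunc (abs_trunc x :: ('a, 'n) trunc) = {y. ?R x y}" if "?R x x" for x
  proof -
    have "?S `` {x} \<in> integers // ?S"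
      using that R_refl by (intro quotientI) simp
    then show ?thesis
      by (simp add: abs_trunc_def trunc_of_coset_inverse Image_def)
  qed
  have ex: "\<exists>x. ?R x x \<and> a = abs_trunc x" for a :: "('a, 'n) trunc"
  proof -
    obtain x where "x \<in> integers" "coset_of_trunc a = ?S `` {x}"
      using coset_of_trunc[of a] by (auto elim: quotientE)
    then show ?thesis
      using R_refl coset by (metis abs_trunc_def coset_of_trunc_inverse)
  qed
  have rep: "?R x (rep_trunc (abs_trunc x :: ('a, 'n) trunc))" if "?R x x" for x
    unfolding rep_trunc_def coset[OF that] using that by (metis mem_Collect_eq someI)
  have abs_eq: "(abs_trunc x :: ('a, 'n) trunc) = abs_trunc y" if "?R x y" for x y
  proof -
    have "{z. ?R x z} = {z. ?R y z}"
      using that symR transR by blast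
    then show ?thesis
      by (simp add: abs_trunc_def Image_def)
  qed
  show ?thesis
    unfolding Quotient_alt_def
  proof (intro conjI allI impI)
    fix x and a :: "('a, 'n) trunc"
    show "cr_trunc x a \<Longrightarrow> abs_trunc x = a"
      by (simp add: cr_trunc_def)
    obtain y where y: "?R y y" "a = abs_trunc y"
      using ex by blast
    then have "?R y (rep_trunc a)"
      using rep by simp
    then show "cr_trunc (rep_trunc a) a"
      using y symR transR abs_eq unfolding cr_trunc_def by metis
  next
    fix x y
    show "?R x y \<longleftrightarrow> cr_trunc x (abs_trunc x :: ('a, 'n) trunc) \<and>
        cr_trunc y (abs_trunc y :: ('a, 'n) trunc) \<and>
        (abs_trunc x :: ('a, 'n) trunc) = abs_trunc y"
      unfolding cr_trunc_def using symR transR abs_eq coset by (metis mem_Collect_eq)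
  qed
qed

setup_lifting Quotient_trunc

instantiation trunc :: (discrete_valued_field, finite) comm_ring_1
begin

lift_definition zero_trunc :: "('a, 'b) trunc" is 0
  by (simp add: val_cong_def integers_def)

lift_definition one_trunc :: "('a, 'b) trunc" is 1
  by (simp add: val_cong_def integers_def)

lift_definition plus_trunc :: "('a, 'b) trunc \<Rightarrow> ('a, 'b) trunc \<Rightarrow> ('a, 'b) trunc" is "(+)"
  unfolding val_cong_def integers_def mem_Collect_eq
  by (metis add_diff_add val_ge_add)

lift_definition uminus_trunc :: "('a, 'b) trunc \<Rightarrow> ('a, 'b) trunc" is uminus
  unfolding val_cong_def integers_def mem_Collect_eq
  by (metis minus_diff_minus val_ge_uminus)

lift_definition minus_trunc :: "('a, 'b) trunc \<Rightarrow> ('a, 'b) trunc \<Rightarrow> ('a, 'b) trunc" is "(-)"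
  unfolding val_cong_def integers_def mem_Collect_eq
  by (metis (no_types, lifting) diff_diff_eq2 diff_add_eq diff_diff_eq add.commute val_ge_diff)

lift_definition times_trunc :: "('a, 'b) trunc \<Rightarrow> ('a, 'b) trunc \<Rightarrow> ('a, 'b) trunc" is "(*)"
proof -
  fix x y z w :: 'a
  assume "val_cong CARD('b) x y" "val_cong CARD('b) z w"
  then have *: "val_ge 0 x" "val_ge 0 y" "val_ge 0 z" "val_ge 0 w"
    "val_ge (int CARD('b)) (x - y)" "val_ge (int CARD('b)) (z - w)"
    by (auto simp: val_cong_def integers_def)
  have "val_ge (int CARD('b)) (x * (z - w))"
    using val_ge_mult[OF *(1,6)] by simp
  moreover have "val_ge (int CARD('b)) ((x - y) * w)"
    using val_ge_mult[OF *(5,4)] by simp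
  ultimately have "val_ge (int CARD('b)) (x * (z - w) + (x - y) * w)"
    by (rule val_ge_add)
  then have "val_ge (int CARD('b)) (x * z - y * w)"
    by (simp add: algebra_simps)
  moreover have "val_ge 0 (x * z)" "val_ge 0 (y * w)"
    using val_ge_mult[OF *(1,3)] val_ge_mult[OF *(2,4)] by simp_all
  ultimately show "val_cong CARD('b) (x * z) (y * w)"
    by (simp add: val_cong_def integers_def)
qed

instance
proof
  fix a b c :: "('a, 'b) trunc"
  show "a * b * c = a * (b * c)"
    by transfer (simp add: val_cong_def integers_def mult.assoc,
      metis add.right_neutral val_ge_mult)
  show "a * b = b * a"
    by transfer (simp add: val_cong_def integers_def mult.commute,
      metis add.right_neutral val_ge_mult)
  show "1 * a = a"
    by transfer simp
  show "a + b + c = a + (b + c)"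
    by transfer (simp add: val_cong_def integers_def add.assoc val_ge_add)
  show "a + b = b + a"
    by transfer (simp add: val_cong_def integers_def add.commute val_ge_add)
  show "0 + a = a"
    by transfer simp
  show "- a + a = 0"
    by transfer (simp add: val_cong_def integers_def)
  show "a - b = a + - b"
    by transfer (simp add: val_cong_def integers_def val_ge_diff)
  show "(a + b) * c = a * c + b * c"
  proof transfer
    fix a b c :: 'a
    assume "val_cong CARD('b) a a" "val_cong CARD('b) b b" "val_cong CARD('b) c c"
    then have *: "val_ge 0 a" "val_ge 0 b" "val_ge 0 c"
      by (auto simp: val_cong_def integers_def)
    have "val_ge 0 (a * c + b * c)"
      using val_ge_add val_ge_mult[OF *(1,3)] val_ge_mult[OF *(2,3)] by simp
    then show "val_cong CARD('b) ((a + b) * c) (a * c + b * c)"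
      by (simp add: val_cong_def integers_def distrib_right)
  qed
  show "(0 :: ('a, 'b) trunc) \<noteq> 1"
    by transfer (simp add: val_cong_def)
qed

end


subsection \<open>Unramified quadratic extensions\<close>

definition uniformizer :: "'a::discrete_valued_field \<Rightarrow> bool"
  where "uniformizer \<pi> \<longleftrightarrow> \<pi> \<noteq> 0 \<and> val \<pi> = 1"

text \<open>
  Both valuations are normalised, so the extension is unramified if and only if the embedding
  preserves them (the residue field extension, being finite, is automatically separable).
\<close>

definition unramified_quadratic_ext ::
    "('f::nonarch_local_field \<Rightarrow> 'e::nonarch_local_field) \<Rightarrow> bool"
  where "unramified_quadratic_ext emb \<longleftrightarrow>
    (\<forall>x y. emb (x + y) = emb x + emb y) \<and>
    (\<forall>x y. emb (x * y) = emb x * emb y) \<and> emb 1 = 1 \<and>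
    vector_space.dim (\<lambda>a z. emb a * z) (UNIV :: 'e set) = 2 \<and>
    (\<forall>x. x \<noteq> 0 \<longrightarrow> val (emb x) = val x)"

definition nontrivial_galois ::
    "('f::nonarch_local_field \<Rightarrow> 'e::nonarch_local_field) \<Rightarrow> ('e \<Rightarrow> 'e) \<Rightarrow> bool"
  where "nontrivial_galois emb \<sigma> \<longleftrightarrow>
    bij \<sigma> \<and> (\<forall>x y. \<sigma> (x + y) = \<sigma> x + \<sigma> y) \<and> (\<forall>x y. \<sigma> (x * y) = \<sigma> x * \<sigma> y) \<and>
    (\<forall>a. \<sigma> (emb a) = emb a) \<and> \<sigma> \<noteq> id"

text \<open>
  The map induced on truncations by a map of fields that preserves integers and congruences:
  this gives the inclusion of \<open>('f, 'n) trunc\<close> into \<open>('e, 'n) trunc\<close>, the action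
  of the Galois group on \<open>('e, 'n) trunc\<close>, and, from the identity, the reduction
  \<open>('e, 'r) trunc \<Rightarrow> ('e, 'l) trunc\<close> when \<open>CARD('l) \<le> CARD('r)\<close>.
\<close>

definition trunc_map ::
    "('a \<Rightarrow> 'b) \<Rightarrow> ('a::discrete_valued_field, 'm::finite) trunc \<Rightarrow> ('b::discrete_valued_field, 'n::finite) trunc"
  where "trunc_map h x = abs_trunc (h (rep_trunc x))"

abbreviation (input) trunc_emb ::
    "('f \<Rightarrow> 'e) \<Rightarrow> ('f::discrete_valued_field, 'n::finite) trunc \<Rightarrow> ('e::discrete_valued_field, 'n) trunc"
  where "trunc_emb \<equiv> trunc_map"

abbreviation (input) trunc_aut ::
    "('e \<Rightarrow> 'e) \<Rightarrow> ('e::discrete_valued_field, 'n::finite) trunc \<Rightarrow> ('e, 'n) trunc"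
  where "trunc_aut \<equiv> trunc_map"

abbreviation (input) reduction :: "('e::discrete_valued_field, 'r::finite) trunc \<Rightarrow> ('e, 'l::finite) trunc"
  where "reduction \<equiv> trunc_map id"

text \<open>
  The inclusion of truncations is injective for an unramified extension.  The inverse below is
  only applied to elements in its range, such as traces and norms.
\<close>

definition trunc_descend ::
    "('f \<Rightarrow> 'e) \<Rightarrow> ('e::discrete_valued_field, 'n::finite) trunc \<Rightarrow> ('f::discrete_valued_field, 'n) trunc"
  where "trunc_descend emb = inv (trunc_emb emb)"

definition ext_Tr ::
    "('f \<Rightarrow> 'e) \<Rightarrow> ('e \<Rightarrow> 'e) \<Rightarrow> ('e::discrete_valued_field, 'n::finite) trunc \<Rightarrow> ('f::discrete_valued_field, 'n) trunc"
  where "ext_Tr emb \<sigma> z = trunc_descend emb (z + trunc_aut \<sigma> z)"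

definition ext_N ::
    "('f \<Rightarrow> 'e) \<Rightarrow> ('e \<Rightarrow> 'e) \<Rightarrow> ('e::discrete_valued_field, 'n::finite) trunc \<Rightarrow> ('f::discrete_valued_field, 'n) trunc"
  where "ext_N emb \<sigma> z = trunc_descend emb (z * trunc_aut \<sigma> z)"


subsection \<open>Characters\<close>

text \<open>Smoothness of an additive character is implied by its triviality on a power of the maximal ideal.\<close>

definition additive_character_of_level :: "nat \<Rightarrow> ('f::discrete_valued_field \<Rightarrow> complex) \<Rightarrow> bool"
  where "additive_character_of_level r \<psi> \<longleftrightarrow>
    (\<forall>x\<in>integers. \<psi> x \<noteq> 0) \<and>
    (\<forall>x\<in>integers. \<forall>y\<in>integers. \<psi> (x + y) = \<psi> x * \<psi> y) \<and>
    (\<forall>x. val_ge (int r) x \<longrightarrow> \<psi> x = 1) \<and>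
    \<not> (\<forall>x. val_ge (int r - 1) x \<longrightarrow> \<psi> x = 1)"

definition trunc_character ::
    "('f \<Rightarrow> complex) \<Rightarrow> ('f::discrete_valued_field, 'n::finite) trunc \<Rightarrow> complex"
  where "trunc_character \<psi> x = \<psi> (rep_trunc x)"

definition unit_character :: "('a::comm_ring_1 \<Rightarrow> complex) \<Rightarrow> bool"
  where "unit_character \<nu> \<longleftrightarrow>
    (\<forall>x. x dvd 1 \<longrightarrow> \<nu> x \<noteq> 0) \<and>
    (\<forall>x y. x dvd 1 \<longrightarrow> y dvd 1 \<longrightarrow> \<nu> (x * y) = \<nu> x * \<nu> y)"

definition regular_couple ::
    "'e \<Rightarrow> ('e \<Rightarrow> 'e) \<Rightarrow> (('e::discrete_valued_field, 'r::finite) trunc \<Rightarrow> complex) \<Rightarrow>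
      (('e, 'r) trunc \<Rightarrow> complex) \<Rightarrow> bool"
  where "regular_couple \<pi> \<sigma> \<nu> \<nu>' \<longleftrightarrow>
    (\<exists>z. trunc_aut \<sigma> z = - z \<and>
      (let u = 1 + abs_trunc \<pi> ^ (CARD('r) - 1) * z in \<nu> u * inverse (\<nu>' u) \<noteq> 1))"

text \<open>
  The parameter of a regular couple is an element of the truncation at \<open>l = CARD('l)\<close>; its
  product with the \<open>l\<close>-th power of the uniformizer in the truncation at
  \<open>CARD('r) = 2 * l\<close> is formed with any lift.
\<close>

definition associated_parameter ::
    "('f::discrete_valued_field \<Rightarrow> 'e) \<Rightarrow> ('e \<Rightarrow> 'e) \<Rightarrow> ('f \<Rightarrow> complex) \<Rightarrow> 'e \<Rightarrow>
      (('e::discrete_valued_field, 'r::finite) trunc \<Rightarrow> complex) \<Rightarrow> (('e, 'r) trunc \<Rightarrow> complex) \<Rightarrow>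
      ('e, 'l::finite) trunc \<Rightarrow> bool"
  where "associated_parameter emb \<sigma> \<psi> \<pi> \<nu> \<nu>' \<tau> \<longleftrightarrow>
    (\<forall>t. reduction t = \<tau> \<longrightarrow>
      (\<forall>z. \<nu> (1 + abs_trunc \<pi> ^ CARD('l) * z) * \<nu>' (1 + abs_trunc \<pi> ^ CARD('l) * trunc_aut \<sigma> z) =
        trunc_character \<psi> (trunc_descend emb
          (abs_trunc \<pi> ^ CARD('l) * (t * z + trunc_aut \<sigma> t * trunc_aut \<sigma> z)))))"


subsection \<open>Induced representations and their characters\<close>

text \<open>
  The complex functions on a set, as a vector space over the complex numbers; the trace of an
  operator that preserves a finite-dimensional subspace \<open>V\<close> is computed in an arbitrary
  basis of \<open>V\<close>.
\<close>

definition fun_scale :: "complex \<Rightarrow> ('x \<Rightarrow> complex) \<Rightarrow> 'x \<Rightarrow> complex"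
  where "fun_scale c f = (\<lambda>x. c * f x)"

interpretation cfun: vector_space fun_scale
  by unfold_locales (auto simp: fun_scale_def fun_eq_iff algebra_simps)

definition operator_trace ::
    "('x \<Rightarrow> complex) set \<Rightarrow> (('x \<Rightarrow> complex) \<Rightarrow> 'x \<Rightarrow> complex) \<Rightarrow> complex"
  where "operator_trace V L =
    (let B = SOME B. cfun.independent B \<and> cfun.span B = V in \<Sum>b\<in>B. cfun.representation B (L b) b)"

definition GL :: "('a::comm_ring_1 ^ 'n::finite ^ 'n) set"
  where "GL = {g. invertible g}"

text \<open>
  The representation of the general linear group induced by a one-dimensional representation
  \<open>\<omega>\<close> of a subgroup \<open>H\<close>: functions on the group (extended by 0 to all matrices)
  with \<open>f (h g) = \<omega> h * f g\<close>, the group acting by right translation.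
\<close>

definition induced_space ::
    "('a::comm_ring_1 ^ 'n::finite ^ 'n) set \<Rightarrow> ('a ^ 'n ^ 'n \<Rightarrow> complex) \<Rightarrow> ('a ^ 'n ^ 'n \<Rightarrow> complex) set"
  where "induced_space H \<omega> =
    {f. (\<forall>g. g \<notin> GL \<longrightarrow> f g = 0) \<and> (\<forall>h\<in>H. \<forall>g\<in>GL. f (h ** g) = \<omega> h * f g)}"

definition right_translation ::
    "'a::comm_ring_1 ^ 'n::finite ^ 'n \<Rightarrow> ('a ^ 'n ^ 'n \<Rightarrow> complex) \<Rightarrow> 'a ^ 'n ^ 'n \<Rightarrow> complex"
  where "right_translation g f = (\<lambda>x. f (x ** g))"

definition induced_character ::
    "('a::comm_ring_1 ^ 'n::finite ^ 'n) set \<Rightarrow> ('a ^ 'n ^ 'n \<Rightarrow> complex) \<Rightarrow> 'a ^ 'n ^ 'n \<Rightarrow> complex"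
  where "induced_character H \<omega> g = operator_trace (induced_space H \<omega>) (right_translation g)"


subsection \<open>Cuspidal representations\<close>

definition mat2 :: "'a::zero \<Rightarrow> 'a \<Rightarrow> 'a \<Rightarrow> 'a \<Rightarrow> 'a ^ 2 ^ 2"
  where "mat2 a b c d = vector [vector [a, b], vector [c, d]]"

definition congruence_subgroup :: "'a::comm_ring_1 \<Rightarrow> ('a ^ 'n::finite ^ 'n) set"
  where "congruence_subgroup a = {g \<in> GL. \<forall>i j. a dvd (g - mat 1) $ i $ j}"

definition beta_hat ::
    "('f \<Rightarrow> 'e) \<Rightarrow> ('e \<Rightarrow> 'e) \<Rightarrow> ('e::discrete_valued_field, 'r::finite) trunc \<Rightarrow>
      ('f::discrete_valued_field, 'r) trunc ^ 2 ^ 2"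
  where "beta_hat emb \<sigma> t = mat2 0 1 (- ext_N emb \<sigma> t) (ext_Tr emb \<sigma> t)"

definition group_S :: "'a::comm_ring_1 ^ 2 ^ 2 \<Rightarrow> ('a ^ 2 ^ 2) set"
  where "group_S \<beta> = {mat a + mat b ** \<beta> | a b. True} \<inter> GL"

definition group_T :: "nat \<Rightarrow> 'a::comm_ring_1 \<Rightarrow> 'a ^ 2 ^ 2 \<Rightarrow> ('a ^ 2 ^ 2) set"
  where "group_T l \<pi> \<beta> = {s ** k | s k. s \<in> group_S \<beta> \<and> k \<in> congruence_subgroup (\<pi> ^ l)}"

text \<open>
  In the next two definitions, \<open>\<pi>\<close> is a uniformizer of the smaller field and
  \<open>t\<close> is the lift of the parameter of the couple; \<open>l = r / 2\<close>.  The value of the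
  character does not depend on the decomposition \<open>g = s k\<close>.
\<close>

definition box_character ::
    "('f \<Rightarrow> 'e) \<Rightarrow> ('e \<Rightarrow> 'e) \<Rightarrow> ('f \<Rightarrow> complex) \<Rightarrow> 'f \<Rightarrow>
      (('e::discrete_valued_field, 'r::finite) trunc \<Rightarrow> complex) \<Rightarrow> (('e, 'r) trunc \<Rightarrow> complex) \<Rightarrow>
      ('e, 'r) trunc \<Rightarrow> ('f::discrete_valued_field, 'r) trunc ^ 2 ^ 2 \<Rightarrow> complex"
  where "box_character emb \<sigma> \<psi> \<pi> \<nu> \<nu>' t g =
    (THE c. \<exists>a b k.
      mat a + mat b ** beta_hat emb \<sigma> t \<in> GL \<and>
      k \<in> congruence_subgroup (abs_trunc \<pi> ^ (CARD('r) div 2)) \<and>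
      g = (mat a + mat b ** beta_hat emb \<sigma> t) ** k \<and>
      c = \<nu> (trunc_emb emb a + trunc_emb emb b * t) *
          \<nu>' (trunc_emb emb a + trunc_emb emb b * trunc_aut \<sigma> t) *
          trunc_character \<psi> (trace (beta_hat emb \<sigma> t ** (k - mat 1))))"

definition cuspidal_character ::
    "('f \<Rightarrow> 'e) \<Rightarrow> ('e \<Rightarrow> 'e) \<Rightarrow> ('f \<Rightarrow> complex) \<Rightarrow> 'f \<Rightarrow>
      (('e::discrete_valued_field, 'r::finite) trunc \<Rightarrow> complex) \<Rightarrow> (('e, 'r) trunc \<Rightarrow> complex) \<Rightarrow>
      ('e, 'r) trunc \<Rightarrow> ('f::discrete_valued_field, 'r) trunc ^ 2 ^ 2 \<Rightarrow> complex"
  where "cuspidal_character emb \<sigma> \<psi> \<pi> \<nu> \<nu>' t =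
    induced_character (group_T (CARD('r) div 2) (abs_trunc \<pi>) (beta_hat emb \<sigma> t))
      (box_character emb \<sigma> \<psi> \<pi> \<nu> \<nu>' t)"

end

theory Submission
  imports Defs
begin

text \<open>
  The character is computed from Frobenius's formula: up to the factor \<open>1 / |T|\<close> it is the
  sum of the values of the inducing character at \<open>x B x\<^sup>-\<^sup>1\<close>, over those
  \<open>x\<close> in the group for which this conjugate lies in \<open>T\<close>.  Write \<open>B = \<alpha> + \<pi>\<^sup>i N\<close>, where \<open>N\<close>
  is nilpotent and nonzero modulo \<open>\<pi>\<close>.  All three cases rest on a single fact
  (\<open>conj_beta_entry_unit\<close>).  Regularity says that \<open>\<tau> - \<sigma>(\<tau>)\<close> is a unit
  (\<open>regular_parameter_unit\<close>), so the companion matrix \<open>C\<close> with trace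
  \<open>Tr(\<tau>)\<close> and determinant \<open>N(\<tau>)\<close> has no eigenvector over the residue field of the smaller field
  (\<open>charpoly_anisotropic\<close>); consequently the entry \<open>\<gamma>\<^sub>1\<^sub>2\<close> of
  \<open>\<gamma> = x\<^sup>-\<^sup>1 C x\<close> is a unit for every \<open>x\<close>.

  Let \<open>r = 2 l\<close>.  For \<open>i < l\<close> no conjugate of \<open>B\<close> lies in \<open>T\<close>: modulo
  \<open>\<pi>\<^sup>l\<close> the matrix \<open>\<alpha> + \<pi>\<^sup>i N\<close> would be a combination
  \<open>a + b \<gamma>\<close>, whose entry above the diagonal forces \<open>\<pi>\<^sup>i\<^sup>+\<^sup>1\<close> to divide
  \<open>b\<close>, while the entry below the diagonal then forces \<open>\<pi>\<^sup>i\<^sup>+\<^sup>1\<close> to divide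
  \<open>\<pi>\<^sup>i\<close> (\<open>not_conj_mem_box_group\<close>).  For \<open>i \<ge> l\<close> every conjugate is a scalar
  times an element of the congruence subgroup, and the summand is the value at \<open>\<alpha>\<close> of the inducing
  character times an explicit additive character value
  \<open>\<psi>(\<alpha>\<^sup>-\<^sup>1 (\<pi>\<^sup>i \<gamma>\<^sub>1\<^sub>2 + \<pi>\<^sup>i\<^sup>+\<^sup>1 \<beta> \<gamma>\<^sub>2\<^sub>1))\<close>
  (\<open>box_conj\<close>).  Multiplying \<open>x\<close> on the right by \<open>diag(1, v)\<close> multiplies
  \<open>\<gamma>\<^sub>1\<^sub>2\<close> by \<open>v\<close>.  If \<open>i < r - 1\<close>, averaging over
  \<open>v\<close> congruent to 1 modulo \<open>\<pi>\<^sup>r\<^sup>-\<^sup>1\<^sup>-\<^sup>i\<close> sums a nontrivial additive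
  character over the whole ring and gives 0 (\<open>sum_weight_below\<close>).  If \<open>i = r - 1\<close>,
  averaging over all units \<open>v\<close> sums it over the units only and gives minus the number of
  nonunits, that is \<open>- q\<^sup>r\<^sup>-\<^sup>1\<close>; the normalisation is right because the order of the
  group is \<open>|T|\<close> times the number of units (\<open>sum_weight_top\<close>, \<open>card_GL\<close>,
  \<open>card_box_group\<close>).

  This argument takes place over an arbitrary finite ring whose ideals are the powers of one
  principal ideal.  What it needs from the local fields is that the truncations are such rings,
  and that \<open>\<sigma>\<close> acts on them, that is, preserves the valuation (\<open>sigma_integral\<close>,
  which is where completeness enters).
\<close>

section \<open>Characters of induced representations\<close>

lemma sum_fun_apply: "(\<Sum>i\<in>I. F i) x = (\<Sum>i\<in>I. F i x)"
  by (induction I rule: infinite_finite_induct) (auto simp: zero_fun_def plus_fun_def)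

text \<open>
  A family \<open>p\<close> that expands every function of \<open>V\<close> with its own values as
  coefficients behaves like a reproducing kernel, and the trace is the sum of the diagonal of the
  kernel of \<open>L\<close>.  Expanding the basis vectors in the family and exchanging the two sums
  proves this for whichever basis computes the trace.
\<close>

lemma operator_trace_eq_sum_kernel:
  fixes V :: "('x \<Rightarrow> complex) set" and L :: "('x \<Rightarrow> complex) \<Rightarrow> 'x \<Rightarrow> complex"
  assumes V: "cfun.subspace V" and X: "finite X"
    and pV: "\<And>x. x \<in> X \<Longrightarrow> p x \<in> V"
    and expand: "\<And>f. f \<in> V \<Longrightarrow> f = (\<Sum>x\<in>X. fun_scale (f x) (p x))"
    and LV: "\<And>f. f \<in> V \<Longrightarrow> L f \<in> V"
    and L: "module_hom fun_scale fun_scale L"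
  shows "operator_trace V L = (\<Sum>x\<in>X. L (p x) x)"
proof -
  define B where "B = (SOME B. cfun.independent B \<and> cfun.span B = V)"
  have "\<exists>B. cfun.independent B \<and> cfun.span B = V"
    using cfun.basis_exists[of V] V by (metis cfun.span_eq_iff cfun.span_mono subset_antisym)
  then have B: "cfun.independent B" "cfun.span B = V"
    unfolding B_def by (metis (mono_tags, lifting) someI_ex)+
  have "V \<subseteq> cfun.span (p ` X)"
  proof
    fix f assume "f \<in> V"
    have "(\<Sum>x\<in>X. fun_scale (f x) (p x)) \<in> cfun.span (p ` X)"
      by (intro cfun.span_sum cfun.span_scale cfun.span_base imageI)
    then show "f \<in> cfun.span (p ` X)"
      using expand[OF \<open>f \<in> V\<close>] by metis
  qed
  then have fin: "finite B"
    using cfun.independent_span_bound[of "p ` X" B] B X cfun.span_superset by blast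
  have LpV: "L (p x) \<in> cfun.span B" if "x \<in> X" for x
    using pV LV B that by auto
  have rep: "cfun.representation B (L b) b = (\<Sum>x\<in>X. b x * cfun.representation B (L (p x)) b)"
    if "b \<in> B" for b
  proof -
    have "b \<in> V" using that B cfun.span_base by blast
    then have "L b = L (\<Sum>x\<in>X. fun_scale (b x) (p x))"
      using expand by presburger
    also have "\<dots> = (\<Sum>x\<in>X. fun_scale (b x) (L (p x)))"
      by (simp add: module_hom.sum[OF L] module_hom.scale[OF L])
    finally show ?thesis
      using LpV by (simp add: cfun.representation_sum[OF B(1)] cfun.representation_scale[OF B(1)]
          cfun.span_scale del: B(2))
  qed
  have "operator_trace V L = (\<Sum>b\<in>B. \<Sum>x\<in>X. b x * cfun.representation B (L (p x)) b)"
    unfolding operator_trace_def Let_def B_def[symmetric] using rep by (rule sum.cong[OF refl])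
  also have "\<dots> = (\<Sum>x\<in>X. (\<Sum>b\<in>B. fun_scale (cfun.representation B (L (p x)) b) b) x)"
    by (subst sum.swap) (simp add: sum_fun_apply fun_scale_def mult.commute)
  also have "\<dots> = (\<Sum>x\<in>X. L (p x) x)"
    using B fin LpV by (intro sum.cong refl) (simp add: cfun.sum_representation_eq)
  finally show ?thesis .
qed

lemma GL_inverse:
  assumes "g \<in> GL"
  shows "g ** matrix_inv g = mat 1" "matrix_inv g ** g = mat 1"
  using assms unfolding GL_def invertible_def matrix_inv_def
  by (metis (mono_tags, lifting) mem_Collect_eq someI_ex)+

lemma GL_matrix_inv: "g \<in> GL \<Longrightarrow> matrix_inv g \<in> GL"
  using GL_inverse unfolding GL_def invertible_def by blast

lemma GL_mult: "g \<in> GL \<Longrightarrow> h \<in> GL \<Longrightarrow> g ** h \<in> GL"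
  unfolding GL_def using invertible_mult by auto

lemma GL_mult_left_cancel: "g \<in> GL \<Longrightarrow> h ** g \<in> GL \<longleftrightarrow> h \<in> GL"
  by (metis GL_inverse(1) GL_matrix_inv GL_mult matrix_mul_assoc matrix_mul_rid)

text \<open>
  Frobenius's formula.  Averaging a point mass over \<open>H\<close> with weight \<open>\<omega>\<close> gives
  a reproducing kernel of the induced space, and the formula is the diagonal sum of its translate.
\<close>

lemma induced_character_eq_sum:
  fixes H :: "('a::{comm_ring_1,finite} ^ 'n::finite ^ 'n) set"
  assumes HG: "H \<subseteq> GL" and H1: "mat 1 \<in> H"
    and Hmult: "\<And>h k. h \<in> H \<Longrightarrow> k \<in> H \<Longrightarrow> h ** k \<in> H"
    and Hinv: "\<And>h. h \<in> H \<Longrightarrow> matrix_inv h \<in> H"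
    and w1: "\<omega> (mat 1) = 1"
    and wmult: "\<And>h k. h \<in> H \<Longrightarrow> k \<in> H \<Longrightarrow> \<omega> (h ** k) = \<omega> h * \<omega> k"
    and g: "g \<in> GL"
  shows "induced_character H \<omega> g =
    (\<Sum>x\<in>GL. if x ** g ** matrix_inv x \<in> H then \<omega> (x ** g ** matrix_inv x) else 0) / of_nat (card H)"
proof -
  define p :: "'a ^ 'n ^ 'n \<Rightarrow> 'a ^ 'n ^ 'n \<Rightarrow> complex" where
    "p x y = (if y \<in> GL \<and> y ** matrix_inv x \<in> H then \<omega> (y ** matrix_inv x) / of_nat (card H) else 0)" for x y
  let ?V = "induced_space H \<omega>"
  have cardH: "card H \<noteq> 0" using H1 finite[of H] card_0_eq by blast
  have Hmult_iff: "h ** k \<in> H \<longleftrightarrow> k \<in> H" if "h \<in> H" for h k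
  proof
    assume "h ** k \<in> H"
    then have "matrix_inv h ** (h ** k) \<in> H" using Hinv Hmult that by blast
    moreover have "matrix_inv h ** h = mat 1" using that HG GL_inverse by blast
    ultimately show "k \<in> H" by (simp add: matrix_mul_assoc)
  qed (use Hmult that in blast)
  have V: "cfun.subspace ?V"
    by (rule cfun.subspaceI) (auto simp: induced_space_def fun_scale_def algebra_simps)
  have pV: "p x \<in> ?V" if "x \<in> GL" for x
  proof -
    have "p x (h ** y) = \<omega> h * p x y" if h: "h \<in> H" and y: "y \<in> GL" for h y
    proof -
      have "h ** y ** matrix_inv x \<in> H \<longleftrightarrow> y ** matrix_inv x \<in> H"
        using Hmult_iff h by (simp add: matrix_mul_assoc[symmetric])
      moreover have "h ** y \<in> GL" using h y HG GL_mult by blast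
      ultimately show ?thesis
        using wmult[of h "y ** matrix_inv x"] h y by (simp add: p_def matrix_mul_assoc)
    qed
    then show ?thesis by (simp add: induced_space_def p_def)
  qed
  have expand: "f = (\<Sum>x\<in>GL. fun_scale (f x) (p x))" if f: "f \<in> ?V" for f
  proof
    fix y
    show "f y = (\<Sum>x\<in>GL. fun_scale (f x) (p x)) y"
    proof (cases "y \<in> GL")
      case False
      then show ?thesis using f by (simp add: induced_space_def sum_fun_apply fun_scale_def p_def)
    next
      case y: True
      have fh: "f (h ** g) = \<omega> h * f g" if "h \<in> H" "g \<in> GL" for h g
        using f that by (simp add: induced_space_def)
      \<comment> \<open>only the coset of \<open>y\<close> contributes, and it contributes equal terms\<close>
      have bij: "bij_betw (\<lambda>h. matrix_inv h ** y) H {x \<in> GL. y ** matrix_inv x \<in> H}"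
      proof (rule bij_betw_byWitness[where f' = "\<lambda>x. y ** matrix_inv x"])
        have inv: "y ** matrix_inv (matrix_inv h ** y) = h" if "h \<in> H" for h
        proof -
          have h: "h \<in> GL" using that HG by blast
          have "matrix_inv h ** y \<in> GL" using h y GL_mult GL_matrix_inv by blast
          note i = GL_inverse[OF this]
          have "y ** matrix_inv (matrix_inv h ** y) = h ** ((matrix_inv h ** y) ** matrix_inv (matrix_inv h ** y))"
            by (simp add: matrix_mul_assoc GL_inverse[OF h])
          then show ?thesis using i by simp
        qed
        then show "\<forall>h\<in>H. y ** matrix_inv (matrix_inv h ** y) = h" by blast
        show "\<forall>x\<in>{x \<in> GL. y ** matrix_inv x \<in> H}. matrix_inv (y ** matrix_inv x) ** y = x"
        proof clarify
          fix x assume x: "x \<in> GL" "y ** matrix_inv x \<in> H"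
          note i = GL_inverse[of "y ** matrix_inv x"]
          have "matrix_inv (y ** matrix_inv x) ** y = matrix_inv (y ** matrix_inv x) ** (y ** matrix_inv x) ** x"
            using GL_inverse[OF x(1)] by (simp add: matrix_mul_assoc[symmetric])
          then show "matrix_inv (y ** matrix_inv x) ** y = x" using i x HG by auto
        qed
        show "(\<lambda>h. matrix_inv h ** y) ` H \<subseteq> {x \<in> GL. y ** matrix_inv x \<in> H}"
          using inv HG by (auto intro!: GL_matrix_inv GL_mult y)
        show "(\<lambda>x. y ** matrix_inv x) ` {x \<in> GL. y ** matrix_inv x \<in> H} \<subseteq> H" by blast
      qed
      have "(\<Sum>x\<in>GL. fun_scale (f x) (p x)) y = (\<Sum>x\<in>GL. f x * p x y)"
        by (simp add: sum_fun_apply fun_scale_def)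
      also have "\<dots> = (\<Sum>x\<in>{x \<in> GL. y ** matrix_inv x \<in> H}. f x * p x y)"
        by (rule sum.mono_neutral_right) (auto simp: p_def)
      also have "\<dots> = (\<Sum>x\<in>{x \<in> GL. y ** matrix_inv x \<in> H}. f y / of_nat (card H))"
      proof (intro sum.cong refl)
        fix x assume "x \<in> {x \<in> GL. y ** matrix_inv x \<in> H}"
        then have x: "x \<in> GL" "y ** matrix_inv x \<in> H" by auto
        have "f y = f ((y ** matrix_inv x) ** x)"
          using GL_inverse[OF x(1)] by (simp add: matrix_mul_assoc[symmetric])
        also have "\<dots> = \<omega> (y ** matrix_inv x) * f x" by (rule fh[OF x(2,1)])
        finally show "f x * p x y = f y / of_nat (card H)" using x y by (simp add: p_def)
      qed
      also have "\<dots> = f y"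
        using bij_betw_same_card[OF bij] cardH by simp
      finally show ?thesis by simp
    qed
  qed
  have LV: "right_translation g f \<in> ?V" if "f \<in> ?V" for f
    using that g GL_mult_left_cancel[OF g] GL_mult[OF _ g]
    by (auto simp: induced_space_def right_translation_def matrix_mul_assoc[symmetric])
  have L: "module_hom fun_scale fun_scale (right_translation g)"
    by unfold_locales (auto simp: right_translation_def fun_scale_def)
  have "induced_character H \<omega> g = (\<Sum>x\<in>GL. p x (x ** g))"
    unfolding induced_character_def
    using operator_trace_eq_sum_kernel[OF V _ pV expand LV L] by (simp add: right_translation_def)
  also have "\<dots> = (\<Sum>x\<in>GL. (if x ** g ** matrix_inv x \<in> H then \<omega> (x ** g ** matrix_inv x) else 0) / of_nat (card H))"
    using GL_mult[OF _ g] by (intro sum.cong refl) (simp add: p_def)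
  finally show ?thesis by (simp add: sum_divide_distrib)
qed

section \<open>Matrices of size two over a commutative ring\<close>

lemma mat2_nth [simp]:
  "mat2 a b c d $ 1 $ 1 = a" "mat2 a b c d $ 1 $ 2 = b"
  "mat2 a b c d $ 2 $ 1 = c" "mat2 a b c d $ 2 $ 2 = d"
  by (simp_all add: mat2_def)

lemma mat2_eqI:
  "A $ 1 $ 1 = B $ 1 $ 1 \<Longrightarrow> A $ 1 $ 2 = B $ 1 $ 2 \<Longrightarrow> A $ 2 $ 1 = B $ 2 $ 1 \<Longrightarrow> A $ 2 $ 2 = B $ 2 $ 2 \<Longrightarrow> A = B"
  for A B :: "'a ^ 2 ^ 2"
  by (simp add: vec_eq_iff forall_2)

lemma mat2_eta: "mat2 (A $ 1 $ 1) (A $ 1 $ 2) (A $ 2 $ 1) (A $ 2 $ 2) = A"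
  by (rule mat2_eqI) simp_all

lemma matrix_mul_2_nth: "(A ** B) $ i $ j = A $ i $ 1 * B $ 1 $ j + A $ i $ 2 * B $ 2 $ j"
  for A B :: "'a::semiring_1 ^ 2 ^ 2"
  by (simp add: matrix_matrix_mult_def sum_2)

lemma mat_2_nth [simp]:
  "(mat a :: 'a::zero ^ 2 ^ 2) $ 1 $ 1 = a" "(mat a :: 'a ^ 2 ^ 2) $ 1 $ 2 = 0"
  "(mat a :: 'a ^ 2 ^ 2) $ 2 $ 1 = 0" "(mat a :: 'a ^ 2 ^ 2) $ 2 $ 2 = a"
  by (simp_all add: mat_def)

lemma trace_2: "trace (A :: 'a::comm_ring_1 ^ 2 ^ 2) = A $ 1 $ 1 + A $ 2 $ 2"
  by (simp add: trace_def sum_2)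

lemmas mat2_simps = matrix_mul_2_nth trace_2 det_2

lemma GL_2_iff: "A \<in> GL \<longleftrightarrow> det A dvd 1" for A :: "'a::comm_ring_1 ^ 2 ^ 2"
proof
  assume "A \<in> GL"
  then obtain B where "A ** B = mat 1" unfolding GL_def invertible_def by blast
  then have "det A * det B = 1" using det_mul[of A B] by simp
  then show "det A dvd 1" by (metis dvd_triv_left)
next
  assume "det A dvd 1"
  then obtain u where u: "1 = det A * u" by (elim dvdE)
  define B where "B = mat2 (u * A $ 2 $ 2) (- u * A $ 1 $ 2) (- u * A $ 2 $ 1) (u * A $ 1 $ 1)"
  have "A ** B = mat 1" "B ** A = mat 1"
    using u by (auto intro!: mat2_eqI simp: B_def mat2_simps algebra_simps)
  then show "A \<in> GL" unfolding GL_def invertible_def by blast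
qed

lemma matrix_diff_ldistrib: "A ** (B - C) = A ** B - A ** C"
  for A B C :: "'a::ring_1 ^ 'n ^ 'n"
  by (simp add: vec_eq_iff matrix_matrix_mult_def sum_subtractf right_diff_distrib)

lemma matrix_diff_rdistrib: "(A - B) ** C = A ** C - B ** C"
  for A B C :: "'a::ring_1 ^ 'n ^ 'n"
  by (simp add: vec_eq_iff matrix_matrix_mult_def sum_subtractf left_diff_distrib)

lemma matrix_add_rdistrib: "(A + B) ** C = A ** C + B ** C"
  for A B C :: "'a::semiring_1 ^ 'n ^ 'n"
  by (simp add: vec_eq_iff matrix_matrix_mult_def sum.distrib distrib_right)

lemma unit_mult: "a dvd 1 \<Longrightarrow> b dvd 1 \<Longrightarrow> a * b dvd 1" for a b :: "'a::comm_monoid_mult"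
  by (metis mult_dvd_mono mult_1_right)

definition mat_dvd :: "'a::comm_ring_1 \<Rightarrow> 'a ^ 'n::finite ^ 'n \<Rightarrow> bool"
  where "mat_dvd c A \<longleftrightarrow> (\<forall>i j. c dvd A $ i $ j)"

lemma mat_dvd_mult_left: "mat_dvd c A \<Longrightarrow> mat_dvd c (B ** A)"
  by (simp add: mat_dvd_def matrix_matrix_mult_def dvd_sum)

lemma mat_dvd_mult_right: "mat_dvd c A \<Longrightarrow> mat_dvd c (A ** B)"
  by (simp add: mat_dvd_def matrix_matrix_mult_def dvd_sum)

lemma mat_dvd_mult: "mat_dvd c A \<Longrightarrow> mat_dvd d B \<Longrightarrow> mat_dvd (c * d) (A ** B)"
  by (simp add: mat_dvd_def matrix_matrix_mult_def dvd_sum mult_dvd_mono)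

lemma mat_dvd_add: "mat_dvd c A \<Longrightarrow> mat_dvd c B \<Longrightarrow> mat_dvd c (A + B)"
  by (simp add: mat_dvd_def)

lemma mat_dvd_zero: "mat_dvd 0 A \<longleftrightarrow> A = 0"
  by (simp add: mat_dvd_def vec_eq_iff)

lemma mat_dvd_minus: "mat_dvd c (- A) \<longleftrightarrow> mat_dvd c A"
  by (simp add: mat_dvd_def)

lemma congruence_subgroup_iff: "g \<in> congruence_subgroup c \<longleftrightarrow> g \<in> GL \<and> mat_dvd c (g - mat 1)"
  by (simp add: congruence_subgroup_def mat_dvd_def)


section \<open>Finite chain rings\<close>

lemma sum_additive_character_eq_0:
  fixes f :: "'a::{ab_group_add,finite} \<Rightarrow> complex"
  assumes "\<And>x y. f (x + y) = f x * f y" and "f x0 \<noteq> 1"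
  shows "(\<Sum>x\<in>UNIV. f x) = 0"
proof -
  have "(\<Sum>x\<in>UNIV. f x) = (\<Sum>x\<in>UNIV. f (x0 + x))"
    by (rule sum.reindex_bij_witness[of _ "\<lambda>x. x0 + x" "\<lambda>x. - x0 + x"]) auto
  also have "\<dots> = f x0 * (\<Sum>x\<in>UNIV. f x)"
    by (simp add: assms(1) sum_distrib_left)
  finally show ?thesis using assms(2) by (metis mult_cancel_right mult_1)
qed

text \<open>
  The finite local rings whose maximal ideal is generated by a nilpotent element \<open>p\<close>;
  \<open>r\<close> is the exact order of nilpotency.  Truncations of discrete valuation rings with
  finite residue field are the examples of interest.
\<close>

locale finite_chain_ring =
  fixes p :: "'a::{comm_ring_1,finite}" and r :: nat
  assumes p_pow_r: "p ^ r = 0"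
    and p_pow_pred_nonzero: "p ^ (r - 1) \<noteq> 0"
    and unit_or_dvd: "x dvd 1 \<or> p dvd x"
begin

lemma r_pos: "0 < r"
  using p_pow_r by (cases r) auto

lemma p_pow_eq_0: "r \<le> k \<Longrightarrow> p ^ k = 0"
  using p_pow_r by (metis le_add_diff_inverse mult_zero_left power_add)

lemma unit_iff: "x dvd 1 \<longleftrightarrow> \<not> p dvd x"
proof
  assume "x dvd 1"
  show "\<not> p dvd x"
  proof
    assume "p dvd x"
    with \<open>x dvd 1\<close> have "p dvd 1" using dvd_trans by blast
    then have "p ^ r dvd 1 ^ r" by (rule dvd_power_same)
    then show False by (simp add: p_pow_r)
  qed
qed (use unit_or_dvd in blast)

lemma p_dvd_p_pow: "0 < k \<Longrightarrow> p dvd p ^ k"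
  by (simp add: dvd_power)

lemma dvd_of_pow_mult_eq_0:
  assumes "k < r" "p ^ k * x = 0" shows "p dvd x"
proof (rule ccontr)
  assume "\<not> p dvd x"
  then obtain u where u: "1 = x * u" using unit_iff[of x] by (blast elim: dvdE)
  have "p ^ k = p ^ k * x * u" using u by (simp add: mult.assoc)
  then have "p ^ k = 0" using assms by simp
  then have "p ^ (r - 1) = 0" using assms(1)
    by (metis One_nat_def Suc_pred le_add_diff_inverse less_Suc_eq_le mult_zero_left power_add r_pos)
  then show False using p_pow_pred_nonzero by simp
qed

lemma not_p_pow_Suc_dvd:
  assumes "k < r" shows "\<not> p ^ Suc k dvd p ^ k"
proof
  assume "p ^ Suc k dvd p ^ k"
  then obtain y where "p ^ k = p ^ Suc k * y" by (rule dvdE)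
  then have "p ^ k = p ^ k * (p * y)" by (simp add: ac_simps)
  then have "p ^ k * (1 - p * y) = 0" by (simp add: algebra_simps)
  then have "p dvd 1 - p * y" using dvd_of_pow_mult_eq_0 assms by blast
  then have "p dvd 1 - p * y + p * y" by (meson dvd_add dvd_triv_left)
  then show False using unit_iff[of 1] by simp
qed

lemma p_pow_dvd_of_p_mult_eq_0:
  assumes "p * x = 0" "k < r" shows "p ^ k dvd x"
  using assms(2)
proof (induction k)
  case (Suc k)
  then obtain y where y: "x = p ^ k * y" by (auto elim: dvdE)
  then have "p ^ Suc k * y = 0" using assms by (simp add: mult.assoc)
  then have "p dvd y" using dvd_of_pow_mult_eq_0 Suc by blast
  then show ?case using y by (simp add: mult.commute mult_dvd_mono)
qed simp

text \<open>
  Multiplication by \<open>p\<close> maps the \<open>k\<close>-th power of the maximal ideal onto the next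
  one, and its kernel is the socle, the ideal generated by \<open>p ^ (r - 1)\<close>.
\<close>

lemma card_ideal_Suc:
  assumes k: "k < r"
  shows "card {x. p ^ k dvd x} = card {x. p ^ (r - 1) dvd x} * card {x. p ^ Suc k dvd x}"
proof -
  let ?I = "\<lambda>k. {x. p ^ k dvd x}"
  define h where "h y = (SOME x. p ^ k dvd x \<and> p * x = y)" for y
  have h: "p ^ k dvd h y" "p * h y = y" if "p ^ Suc k dvd y" for y
  proof -
    have "\<exists>x. p ^ k dvd x \<and> p * x = y"
      using that by (metis dvdE dvd_triv_left mult.assoc power_Suc)
    then show "p ^ k dvd h y" "p * h y = y"
      unfolding h_def by (metis (mono_tags, lifting) someI_ex)+
  qed
  have socle: "p * s = 0" if "p ^ (r - 1) dvd s" for s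
  proof -
    obtain y where "s = p ^ (r - 1) * y" using \<open>p ^ (r - 1) dvd s\<close> by (rule dvdE)
    then have "p * s = p ^ Suc (r - 1) * y" by (simp add: mult.assoc)
    then show ?thesis using p_pow_r r_pos by simp
  qed
  have socle_k: "p ^ k dvd s" if "p ^ (r - 1) dvd s" for s
  proof -
    have "p ^ k dvd p ^ (r - 1)" using k by (simp add: le_imp_power_dvd)
    then show ?thesis using \<open>p ^ (r - 1) dvd s\<close> dvd_trans by blast
  qed
  have "bij_betw (\<lambda>(s, y). s + h y) (?I (r - 1) \<times> ?I (Suc k)) (?I k)"
  proof (rule bij_betw_byWitness[where f' = "\<lambda>x. (x - h (p * x), p * x)"])
    show "\<forall>a\<in>?I (r - 1) \<times> ?I (Suc k). (\<lambda>x. (x - h (p * x), p * x)) (case a of (s, y) \<Rightarrow> s + h y) = a"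
      using h socle by (auto simp: distrib_left)
    show "\<forall>a\<in>?I k. (case (a - h (p * a), p * a) of (s, y) \<Rightarrow> s + h y) = a"
      by auto
    show "(\<lambda>(s, y). s + h y) ` (?I (r - 1) \<times> ?I (Suc k)) \<subseteq> ?I k"
      using h socle_k by auto
    show "(\<lambda>x. (x - h (p * x), p * x)) ` ?I k \<subseteq> ?I (r - 1) \<times> ?I (Suc k)"
    proof clarsimp
      fix x assume "p ^ k dvd x"
      then have *: "p ^ Suc k dvd p * x" by (simp add: mult_dvd_mono)
      then have "p * (x - h (p * x)) = 0" using h by (simp add: right_diff_distrib)
      then show "p ^ (r - Suc 0) dvd x - h (p * x) \<and> p * p ^ k dvd p * x"
        using p_pow_dvd_of_p_mult_eq_0[of _ "r - 1"] r_pos * by simp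
    qed
  qed
  then show ?thesis
    using bij_betw_same_card card_cartesian_product by metis
qed

text \<open>
  The socle is one-dimensional over the residue field, so its order stands for the cardinality
  of the residue field.
\<close>

lemma card_ideal:
  assumes "k \<le> r"
  shows "card {x. p ^ k dvd x} = card {x. p ^ (r - 1) dvd x} ^ (r - k)"
  using assms
proof (induction k rule: inc_induct)
  case base
  then show ?case by (simp add: p_pow_r)
next
  case (step k)
  then show ?case using card_ideal_Suc[of k] by (simp add: Suc_diff_Suc[symmetric] del: Suc_diff_Suc)
qed

end

section \<open>Companion matrices without eigenvectors modulo the maximal ideal\<close>

text \<open>
  The binary quadratic form is the homogenised characteristic polynomial of the companion matrix
  \<open>\<beta>\<close>.  Having no nontrivial zero modulo \<open>p\<close> means that \<open>\<beta>\<close> has no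
  eigenvector over the residue field, in other words that \<open>\<beta>\<close> generates a quadratic field
  there.
\<close>

locale elliptic_matrix = finite_chain_ring p r
  for p :: "'a::{comm_ring_1,finite}" and r +
  fixes tr nm :: 'a
  assumes anisotropic: "p dvd d\<^sup>2 - tr * b * d + nm * b\<^sup>2 \<Longrightarrow> p dvd b \<and> p dvd d"
begin

definition \<beta> :: "'a ^ 2 ^ 2" where "\<beta> = mat2 0 1 (- nm) tr"

text \<open>
  The elements of the algebra generated by \<open>\<beta>\<close>; the invertible ones form the group
  \<open>S\<close>, whose product with the congruence subgroup is the inducing subgroup.
\<close>

definition lin :: "'a \<Rightarrow> 'a \<Rightarrow> 'a ^ 2 ^ 2" where "lin a b = mat a + mat b ** \<beta>"

lemma beta_nth [simp]: "\<beta> $ 1 $ 1 = 0" "\<beta> $ 1 $ 2 = 1" "\<beta> $ 2 $ 1 = - nm" "\<beta> $ 2 $ 2 = tr"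
  by (simp_all add: \<beta>_def)

lemma lin_nth [simp]:
  "lin a b $ 1 $ 1 = a" "lin a b $ 1 $ 2 = b" "lin a b $ 2 $ 1 = - nm * b" "lin a b $ 2 $ 2 = a + tr * b"
  by (simp_all add: lin_def mat2_simps mult.commute)

lemma lin_one: "lin 1 0 = mat 1" and lin_scalar: "lin a 0 = mat a"
  by (auto intro!: mat2_eqI)

lemma lin_mult: "lin a b ** lin c d = lin (a * c - nm * b * d) (a * d + b * c + tr * b * d)"
  by (rule mat2_eqI) (simp_all add: mat2_simps algebra_simps)

lemma lin_commute_beta: "lin a b ** \<beta> = \<beta> ** lin a b"
  by (rule mat2_eqI) (simp_all add: mat2_simps algebra_simps)

abbreviation primitive :: "'a \<Rightarrow> 'a \<Rightarrow> bool" where "primitive b d \<equiv> \<not> (p dvd b \<and> p dvd d)"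

lemma form_unit_iff: "d\<^sup>2 - tr * b * d + nm * b\<^sup>2 dvd 1 \<longleftrightarrow> primitive b d"
proof -
  have "p dvd d\<^sup>2 - tr * b * d + nm * b\<^sup>2" if "p dvd b" "p dvd d"
    using that by (auto simp: power2_eq_square intro!: dvd_add dvd_diff)
  then show ?thesis using unit_iff anisotropic by blast
qed

text \<open>
  The determinant of \<open>lin a b\<close> is a value of the anisotropic form.
\<close>

lemma lin_GL_iff: "lin a b \<in> GL \<longleftrightarrow> primitive a b"
proof -
  have "det (lin a b) = (a + tr * b)\<^sup>2 - tr * b * (a + tr * b) + nm * b\<^sup>2"
    by (simp add: det_2 algebra_simps power2_eq_square)
  moreover have "p dvd a + tr * b \<longleftrightarrow> p dvd a" if "p dvd b"
    using that by (simp add: dvd_add_left_iff)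
  ultimately show ?thesis
    unfolding GL_2_iff using form_unit_iff[of "a + tr * b" b] by auto
qed

lemma lin_inverse:
  assumes "lin a b \<in> GL"
  obtains c d where "lin a b ** lin c d = mat 1" "lin c d ** lin a b = mat 1" "lin c d \<in> GL"
proof -
  obtain u where u: "1 = det (lin a b) * u"
    using assms unfolding GL_2_iff by (rule dvdE)
  have "lin a b ** lin (u * (a + tr * b)) (- u * b) = mat 1"
    "lin (u * (a + tr * b)) (- u * b) ** lin a b = mat 1"
    using u by (auto intro!: mat2_eqI simp: mat2_simps algebra_simps)
  moreover from this have "lin (u * (a + tr * b)) (- u * b) \<in> GL"
    unfolding GL_def invertible_def by blast
  ultimately show ?thesis using that by blast
qed

definition conj_beta :: "'a ^ 2 ^ 2 \<Rightarrow> 'a ^ 2 ^ 2" where "conj_beta x = matrix_inv x ** \<beta> ** x"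

text \<open>
  By Cramer's rule, \<open>det x\<close> times this entry is the anisotropic form evaluated at the
  second column of \<open>x\<close>.  If it vanished modulo \<open>p\<close>, that column would be an eigenvector
  of \<open>\<beta>\<close>.
\<close>

lemma conj_beta_entry_unit:
  assumes "x \<in> GL" shows "conj_beta x $ 1 $ 2 dvd 1"
proof -
  let ?g = "conj_beta x"
  have eq: "x ** ?g = \<beta> ** x"
    by (simp add: conj_beta_def matrix_mul_assoc GL_inverse[OF assms])
  have e1: "x $ 1 $ 1 * ?g $ 1 $ 2 + x $ 1 $ 2 * ?g $ 2 $ 2 = x $ 2 $ 2"
    using arg_cong[OF eq, of "\<lambda>A. A $ 1 $ 2"] by (simp add: mat2_simps)
  have e2: "x $ 2 $ 1 * ?g $ 1 $ 2 + x $ 2 $ 2 * ?g $ 2 $ 2 = - nm * x $ 1 $ 2 + tr * x $ 2 $ 2"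
    using arg_cong[OF eq, of "\<lambda>A. A $ 2 $ 2"] by (simp add: mat2_simps)
  have "det x * ?g $ 1 $ 2 = x $ 2 $ 2 * (x $ 1 $ 1 * ?g $ 1 $ 2 + x $ 1 $ 2 * ?g $ 2 $ 2)
      - x $ 1 $ 2 * (x $ 2 $ 1 * ?g $ 1 $ 2 + x $ 2 $ 2 * ?g $ 2 $ 2)"
    by (simp add: det_2 algebra_simps)
  also have "\<dots> = (x $ 2 $ 2)\<^sup>2 - tr * x $ 1 $ 2 * x $ 2 $ 2 + nm * (x $ 1 $ 2)\<^sup>2"
    unfolding e1 e2 by (simp add: algebra_simps power2_eq_square)
  finally have *: "det x * ?g $ 1 $ 2 = (x $ 2 $ 2)\<^sup>2 - tr * x $ 1 $ 2 * x $ 2 $ 2 + nm * (x $ 1 $ 2)\<^sup>2" .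
  have "primitive (x $ 1 $ 2) (x $ 2 $ 2)"
  proof
    assume "p dvd x $ 1 $ 2 \<and> p dvd x $ 2 $ 2"
    then have "p dvd det x" by (simp add: det_2)
    then show False using assms GL_2_iff unit_iff by blast
  qed
  then have "det x * ?g $ 1 $ 2 dvd 1" unfolding * form_unit_iff .
  then show ?thesis by (metis dvd_mult_right)
qed

lemma card_units: "card {v. v dvd (1::'a)} \<noteq> 0"
proof -
  have "(1::'a) \<in> {v. v dvd 1}" by simp
  then show ?thesis using finite[of "{v. v dvd (1::'a)}"] card_0_eq by blast
qed

text \<open>
  The matrices \<open>lin a b\<close> act simply transitively on primitive vectors, so every invertible
  matrix is uniquely such a matrix times one that fixes the second basis vector.
\<close>

lemma card_GL: "card (GL :: ('a ^ 2 ^ 2) set) = card {(a, b). primitive a b} * card (UNIV :: 'a set) * card {v. v dvd (1::'a)}"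
proof -
  define f :: "('a \<times> 'a) \<times> 'a \<times> 'a \<Rightarrow> 'a ^ 2 ^ 2" where "f = (\<lambda>((a, b), u, w). lin a b ** mat2 w 0 u 1)"
  let ?D = "{(a, b). primitive a b} \<times> (UNIV :: 'a set) \<times> {v. v dvd (1::'a)}"
  have "bij_betw f ?D GL"
    unfolding bij_betw_def
  proof
    show "inj_on f ?D"
    proof (rule inj_onI)
      fix X Y assume XY: "X \<in> ?D" "Y \<in> ?D" "f X = f Y"
      obtain a b u w c d u' w' where X: "X = ((a, b), u, w)" and Y: "Y = ((c, d), u', w')"
        by (metis surj_pair)
      have prim: "primitive a b" "primitive c d" using XY unfolding X Y by blast+
      have eq: "f ((a, b), u, w) = f ((c, d), u', w')" using XY X Y by simp
      have b: "b = d" using arg_cong[OF eq, of "\<lambda>A. A $ 1 $ 2"] by (simp add: f_def mat2_simps)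
      then have a: "a = c" using arg_cong[OF eq, of "\<lambda>A. A $ 2 $ 2"] by (simp add: f_def mat2_simps)
      obtain a' b' where "lin a' b' ** lin a b = mat 1" using lin_inverse lin_GL_iff prim by metis
      moreover have "lin a b ** mat2 w 0 u 1 = lin a b ** mat2 w' 0 u' 1"
        using eq a b by (simp add: f_def)
      ultimately have "mat2 w 0 u 1 = mat2 w' 0 u' 1"
        by (metis matrix_mul_assoc matrix_mul_lid)
      then show "X = Y" unfolding X Y using a b by (metis mat2_nth(1,3))
    qed
    show "f ` ?D = GL"
    proof
      show "f ` ?D \<subseteq> GL"
      proof (rule image_subsetI)
        fix X assume "X \<in> ?D"
        then obtain a b u w where X: "X = ((a, b), u, w)" and prim: "primitive a b" and w: "w dvd 1"
          by blast
        have "det (mat2 w 0 u 1) = w" by (simp add: det_2)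
        then show "f X \<in> GL"
          using prim w unfolding f_def X split_conv by (intro GL_mult) (simp_all only: lin_GL_iff GL_2_iff[of "mat2 w 0 u 1"] not_False_eq_True)
      qed
      show "GL \<subseteq> f ` ?D"
      proof
        fix x :: "'a ^ 2 ^ 2" assume x: "x \<in> GL"
        define b a where "b = x $ 1 $ 2" and "a = x $ 2 $ 2 - tr * b"
        have prim: "primitive a b"
        proof
          assume "p dvd a \<and> p dvd b"
          then have "p dvd b \<and> p dvd a + tr * b" by simp
          then have "p dvd x $ 1 $ 2 \<and> p dvd x $ 2 $ 2" by (simp add: a_def b_def)
          then have "p dvd det x" by (simp add: det_2)
          then show False using x GL_2_iff unit_iff by blast
        qed
        obtain c d where inv: "lin a b ** lin c d = mat 1" "lin c d ** lin a b = mat 1" "lin c d \<in> GL"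
          using lin_inverse lin_GL_iff prim by metis
        define y where "y = lin c d ** x"
        have xy: "x = lin a b ** y" using inv by (simp add: y_def matrix_mul_assoc)
        have y: "y \<in> GL" using inv x GL_mult y_def by blast
        \<comment> \<open>\<open>lin a b\<close> and \<open>x\<close> have the same second column\<close>
        have "y $ 1 $ 2 = (lin c d ** lin a b) $ 1 $ 2" "y $ 2 $ 2 = (lin c d ** lin a b) $ 2 $ 2"
          unfolding y_def by (simp_all add: matrix_mul_2_nth a_def b_def)
        then have "y $ 1 $ 2 = 0" "y $ 2 $ 2 = 1" by (simp_all add: inv)
        then have ym: "y = mat2 (y $ 1 $ 1) 0 (y $ 2 $ 1) 1" by (metis mat2_eta)
        have "y $ 1 $ 1 dvd 1" using y \<open>y $ 1 $ 2 = 0\<close> \<open>y $ 2 $ 2 = 1\<close> by (simp add: GL_2_iff det_2)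
        moreover have "x = f ((a, b), y $ 2 $ 1, y $ 1 $ 1)" using xy ym by (simp add: f_def)
        ultimately show "x \<in> f ` ?D" using prim by blast
      qed
    qed
  qed
  then have "card (GL :: ('a ^ 2 ^ 2) set) = card ?D" using bij_betw_same_card by metis
  then show ?thesis by (simp add: card_cartesian_product)
qed

end

section \<open>The inducing character\<close>

text \<open>
  The function \<open>\<theta>\<close> plays the part of the product of the two characters on
  \<open>S\<close>: the value \<open>\<theta> a b\<close> belongs to the element \<open>lin a b\<close>.  The last
  assumption is the compatibility with \<open>\<psi>\<close> on the intersection of \<open>S\<close> with the
  congruence subgroup that makes a character of the product group possible.
\<close>

locale box_datum = elliptic_matrix p r tr nm
  for p :: "'a::{comm_ring_1,finite}" and r tr nm +
  fixes l :: nat and \<psi> :: "'a \<Rightarrow> complex" and \<theta> :: "'a \<Rightarrow> 'a \<Rightarrow> complex"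
  assumes r_eq: "r = 2 * l"
    and psi_add: "\<psi> (x + y) = \<psi> x * \<psi> y"
    and psi_0: "\<psi> 0 = 1"
    and psi_level: "\<exists>x. \<psi> (p ^ (r - 1) * x) \<noteq> 1"
    and theta_mult: "lin a b \<in> GL \<Longrightarrow> lin c d \<in> GL \<Longrightarrow>
      \<theta> (a * c - nm * b * d) (a * d + b * c + tr * b * d) = \<theta> a b * \<theta> c d"
    and theta_congruence: "\<theta> (1 + p ^ l * a) (p ^ l * b) = \<psi> (trace (\<beta> ** (mat (p ^ l) ** lin a b)))"
begin

abbreviation K :: "('a ^ 2 ^ 2) set" where "K \<equiv> congruence_subgroup (p ^ l)"

text \<open>
  The graph of the inducing character as a relation.  Proving multiplicativity and closure under
  inverses for the relation first gives single-valuedness as a consequence.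
\<close>

definition box_rel :: "'a ^ 2 ^ 2 \<Rightarrow> complex \<Rightarrow> bool" where
  "box_rel g c \<longleftrightarrow> (\<exists>a b k. lin a b \<in> GL \<and> k \<in> K \<and> g = lin a b ** k \<and>
     c = \<theta> a b * \<psi> (trace (\<beta> ** (k - mat 1))))"

lemma box_relI: "lin a b \<in> GL \<Longrightarrow> k \<in> K \<Longrightarrow> box_rel (lin a b ** k) (\<theta> a b * \<psi> (trace (\<beta> ** (k - mat 1))))"
  unfolding box_rel_def by blast

lemma l_pos: "0 < l"
  using r_pos r_eq by simp

lemma theta_one: "\<theta> 1 0 = 1"
  using theta_congruence[of 0 0] by (simp add: mat2_simps psi_0)

lemma K_conj:
  assumes "k \<in> K" "s \<in> GL" "s' \<in> GL" "s ** s' = mat 1"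
  shows "s ** k ** s' \<in> K" "s ** k ** s' - mat 1 = s ** (k - mat 1) ** s'"
proof -
  show eq: "s ** k ** s' - mat 1 = s ** (k - mat 1) ** s'"
    using assms by (simp add: matrix_diff_ldistrib matrix_diff_rdistrib)
  show "s ** k ** s' \<in> K"
    using assms unfolding congruence_subgroup_iff eq
    by (intro conjI GL_mult mat_dvd_mult_right[OF mat_dvd_mult_left]) simp_all
qed

text \<open>
  As \<open>r = 2 l\<close>, products of two elements congruent to 0 modulo \<open>p ^ l\<close> vanish.
\<close>

lemma K_mult:
  assumes "k \<in> K" "k' \<in> K"
  shows "k ** k' \<in> K" "k ** k' - mat 1 = (k - mat 1) + (k' - mat 1)"
proof -
  have dvd: "mat_dvd (p ^ l) (k - mat 1)" "mat_dvd (p ^ l) (k' - mat 1)"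
    using assms by (auto simp: congruence_subgroup_iff)
  have "mat_dvd (p ^ l * p ^ l) ((k - mat 1) ** (k' - mat 1))"
    by (rule mat_dvd_mult[OF dvd])
  then have "(k - mat 1) ** (k' - mat 1) = 0"
    using p_pow_r mat_dvd_zero by (metis r_eq mult_2 power_add)
  then show eq: "k ** k' - mat 1 = (k - mat 1) + (k' - mat 1)"
    by (simp add: matrix_diff_ldistrib matrix_diff_rdistrib algebra_simps del: mult_2)
  show "k ** k' \<in> K"
    using assms mat_dvd_add[OF dvd] unfolding congruence_subgroup_iff eq by (auto intro!: GL_mult)
qed

lemma K_inverse:
  assumes "k \<in> K" shows "matrix_inv k \<in> K"
proof -
  have k: "k \<in> GL" "mat_dvd (p ^ l) (k - mat 1)" using assms by (auto simp: congruence_subgroup_iff)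
  have "matrix_inv k - mat 1 = - (matrix_inv k ** (k - mat 1))"
    using GL_inverse[OF k(1)] by (simp add: matrix_diff_ldistrib)
  then show ?thesis
    using k by (simp add: congruence_subgroup_iff GL_matrix_inv mat_dvd_minus mat_dvd_mult_left)
qed

lemma lin_conj_trace:
  assumes "s = lin c d" "s ** s' = mat 1" "s' ** s = mat 1"
  shows "trace (\<beta> ** (s' ** A ** s)) = trace (\<beta> ** A)"
proof -
  have "trace (\<beta> ** (s' ** A ** s)) = trace ((\<beta> ** s' ** A) ** s)"
    by (simp add: matrix_mul_assoc)
  also have "\<dots> = trace (s ** (\<beta> ** s' ** A))" by (rule trace_mul_sym)
  also have "s ** (\<beta> ** s' ** A) = \<beta> ** (s ** s') ** A"
    using lin_commute_beta[of c d] assms(1) by (simp add: matrix_mul_assoc)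
  finally show ?thesis using assms by simp
qed

text \<open>
  Moving the congruence factor of the first element past the \<open>S\<close> factor of the second one
  conjugates it by an element that commutes with \<open>\<beta>\<close>, which does not change the trace.
\<close>

lemma box_rel_mult:
  assumes "box_rel g c" "box_rel g' c'" shows "box_rel (g ** g') (c * c')"
proof -
  obtain a b k where g: "lin a b \<in> GL" "k \<in> K" "g = lin a b ** k"
    "c = \<theta> a b * \<psi> (trace (\<beta> ** (k - mat 1)))" using assms(1) unfolding box_rel_def by blast
  obtain a' b' k' where g': "lin a' b' \<in> GL" "k' \<in> K" "g' = lin a' b' ** k'"
    "c' = \<theta> a' b' * \<psi> (trace (\<beta> ** (k' - mat 1)))" using assms(2) unfolding box_rel_def by blast
  define s where "s = lin a' b'"
  obtain s' where s': "s ** s' = mat 1" "s' ** s = mat 1" "s' \<in> GL"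
    using lin_inverse[OF g'(1)] s_def by metis
  have s: "s \<in> GL" using g' s_def by simp
  define k'' where "k'' = s' ** k ** s"
  have k'': "k'' \<in> K" "k'' - mat 1 = s' ** (k - mat 1) ** s"
    using K_conj[OF g(2) s'(3) s s'(2)] by (simp_all add: k''_def)
  let ?a = "a * a' - nm * b * b'" and ?b = "a * b' + b * a' + tr * b * b'"
  have ss: "lin ?a ?b = lin a b ** s" by (simp add: lin_mult s_def)
  have "g ** g' = lin a b ** (s ** s') ** k ** s ** k'"
    using g g' s_def s' by (simp add: matrix_mul_assoc)
  then have "g ** g' = lin ?a ?b ** (k'' ** k')"
    by (simp add: ss k''_def matrix_mul_assoc)
  moreover have "lin ?a ?b \<in> GL" using GL_mult[OF g(1) s] unfolding ss .
  moreover note K_mult[OF k''(1) g'(2)]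
  moreover have "c * c' = \<theta> ?a ?b * \<psi> (trace (\<beta> ** (k'' ** k' - mat 1)))"
  proof -
    have "trace (\<beta> ** (k'' ** k' - mat 1)) = trace (\<beta> ** (k'' - mat 1)) + trace (\<beta> ** (k' - mat 1))"
      unfolding K_mult(2)[OF k''(1) g'(2)] by (simp only: matrix_add_ldistrib trace_add)
    also have "trace (\<beta> ** (k'' - mat 1)) = trace (\<beta> ** (k - mat 1))"
      unfolding k''(2) using lin_conj_trace s_def s' by blast
    finally show ?thesis using g g' theta_mult[OF g(1) g'(1)] by (simp add: psi_add)
  qed
  ultimately show ?thesis unfolding box_rel_def by blast
qed

lemma box_rel_inverse:
  assumes "box_rel g c" shows "\<exists>c'. box_rel (matrix_inv g) c'"
proof -
  obtain a b k where g: "lin a b \<in> GL" "k \<in> K" "g = lin a b ** k"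
    using assms(1) unfolding box_rel_def by blast
  obtain a' b' where s': "lin a b ** lin a' b' = mat 1" "lin a' b' ** lin a b = mat 1" "lin a' b' \<in> GL"
    using lin_inverse[OF g(1)] by metis
  have kG: "k \<in> GL" using g by (simp add: congruence_subgroup_iff)
  have gG: "g \<in> GL" using g kG GL_mult by blast
  have "lin a b ** matrix_inv k ** lin a' b' \<in> K"
    using K_conj(1)[OF K_inverse[OF g(2)] g(1) s'(3,1)] .
  note rel = box_relI[OF s'(3) this]
  have "g ** (lin a' b' ** (lin a b ** matrix_inv k ** lin a' b')) = lin a b ** (k ** ((lin a' b' ** lin a b) ** matrix_inv k)) ** lin a' b'"
    by (simp add: g matrix_mul_assoc)
  also have "\<dots> = mat 1" by (simp add: s' GL_inverse[OF kG])
  finally have "matrix_inv g ** (g ** (lin a' b' ** (lin a b ** matrix_inv k ** lin a' b'))) = matrix_inv g"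
    by simp
  then have "matrix_inv g = lin a' b' ** (lin a b ** matrix_inv k ** lin a' b')"
    using GL_inverse(2)[OF gG] by (simp add: matrix_mul_assoc)
  then show ?thesis using rel by metis
qed

text \<open>
  A decomposition of the identity consists of mutually inverse elements in the intersection of
  \<open>S\<close> with the congruence subgroup, where the two recipes agree.
\<close>

lemma box_rel_one:
  assumes "box_rel (mat 1) c" shows "c = 1"
proof -
  obtain a b k where g: "lin a b \<in> GL" "k \<in> K" "mat 1 = lin a b ** k"
    and c: "c = \<theta> a b * \<psi> (trace (\<beta> ** (k - mat 1)))"
    using assms(1) unfolding box_rel_def by blast
  obtain a' b' where s': "lin a b ** lin a' b' = mat 1" "lin a' b' ** lin a b = mat 1" "lin a' b' \<in> GL"
    using lin_inverse[OF g(1)] by metis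
  have k: "k = lin a' b'"
    using g(3) s' by (metis matrix_mul_assoc matrix_mul_lid matrix_mul_rid)
  then have "p ^ l dvd (lin a' b' - mat 1) $ 1 $ 1" "p ^ l dvd (lin a' b' - mat 1) $ 1 $ 2"
    using g(2) unfolding congruence_subgroup_iff mat_dvd_def by blast+
  then obtain x y where xy: "a' = 1 + p ^ l * x" "b' = p ^ l * y"
    by (auto elim!: dvdE simp: algebra_simps)
  have "k - mat 1 = mat (p ^ l) ** lin x y"
    unfolding k by (rule mat2_eqI) (simp_all add: mat2_simps xy algebra_simps)
  then have "c = \<theta> a b * \<theta> a' b'" using c theta_congruence[of x y] xy by simp
  also have "\<dots> = \<theta> (a * a' - nm * b * b') (a * b' + b * a' + tr * b * b')"
    using theta_mult[OF g(1) s'(3)] by simp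
  finally have "c = \<theta> (a * a' - nm * b * b') (a * b' + b * a' + tr * b * b')" .
  moreover have "lin (a * a' - nm * b * b') (a * b' + b * a' + tr * b * b') = lin 1 0"
    using s'(1) by (simp add: lin_mult lin_one)
  then have "a * a' - nm * b * b' = 1" "a * b' + b * a' + tr * b * b' = 0"
    by (metis lin_nth(1), metis lin_nth(2))
  ultimately show ?thesis using theta_one by simp
qed

lemma box_rel_GL: "box_rel g c \<Longrightarrow> g \<in> GL"
  unfolding box_rel_def by (auto simp: congruence_subgroup_iff intro!: GL_mult)

text \<open>
  Two values at the same element have a common inverse, namely any value at the inverse element.
\<close>

lemma box_rel_unique:
  assumes "box_rel g c" "box_rel g d" shows "c = d"
proof -
  obtain e where e: "box_rel (matrix_inv g) e" using box_rel_inverse assms by blast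
  have "c * e = 1" "d * e = 1"
    using box_rel_mult[OF assms(1) e] box_rel_mult[OF assms(2) e]
      GL_inverse(1)[OF box_rel_GL[OF assms(1)]] box_rel_one by auto
  then show ?thesis by (metis mult_cancel_right mult_zero_right zero_neq_one)
qed

definition box_group :: "('a ^ 2 ^ 2) set" where "box_group = {g. \<exists>c. box_rel g c}"
definition box_char :: "'a ^ 2 ^ 2 \<Rightarrow> complex" where "box_char g = (THE c. box_rel g c)"

lemma box_char_eq: "box_rel g c \<Longrightarrow> box_char g = c"
  unfolding box_char_def using box_rel_unique by (blast intro: the_equality)

lemma box_rel_box: "g \<in> box_group \<Longrightarrow> box_rel g (box_char g)"
  unfolding box_group_def using box_char_eq by blast

lemma box_group_eq: "box_group = group_T l p \<beta>"
  unfolding box_group_def group_T_def group_S_def box_rel_def lin_def[symmetric] by auto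

lemma box_group_character:
  shows "box_group \<subseteq> GL" "mat 1 \<in> box_group"
    "g \<in> box_group \<Longrightarrow> h \<in> box_group \<Longrightarrow> g ** h \<in> box_group" "g \<in> box_group \<Longrightarrow> matrix_inv g \<in> box_group"
    "box_char (mat 1) = 1"
    "g \<in> box_group \<Longrightarrow> h \<in> box_group \<Longrightarrow> box_char (g ** h) = box_char g * box_char h"
proof -
  show "box_group \<subseteq> GL" unfolding box_group_def using box_rel_GL by blast
  have "mat 1 \<in> K" by (simp add: congruence_subgroup_iff GL_2_iff mat_dvd_def)
  moreover have "lin 1 0 \<in> GL" by (simp add: lin_one GL_2_iff)
  ultimately have "\<exists>c. box_rel (mat 1) c" using box_relI[of 1 0 "mat 1"] by (auto simp: lin_one)
  then show "mat 1 \<in> box_group" "box_char (mat 1) = 1"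
    using box_rel_one box_char_eq by (auto simp: box_group_def)
  show "g \<in> box_group \<Longrightarrow> h \<in> box_group \<Longrightarrow> g ** h \<in> box_group" using box_rel_mult unfolding box_group_def by blast
  show "g \<in> box_group \<Longrightarrow> matrix_inv g \<in> box_group" using box_rel_inverse by (auto simp: box_group_def)
  show "g \<in> box_group \<Longrightarrow> h \<in> box_group \<Longrightarrow> box_char (g ** h) = box_char g * box_char h"
    using box_rel_mult box_rel_box box_char_eq by blast
qed


text \<open>
  A matrix congruent to \<open>lin a b\<close> modulo \<open>p ^ l\<close> is \<open>lin a b\<close> times an
  element of the congruence subgroup; this turns membership into congruences between entries.
\<close>

lemma box_group_iff: "g \<in> box_group \<longleftrightarrow> g \<in> GL \<and> (\<exists>a b. mat_dvd (p ^ l) (g - lin a b))"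
proof
  assume "g \<in> box_group"
  then obtain a b k where g: "lin a b \<in> GL" "k \<in> K" "g = lin a b ** k"
    unfolding box_group_def box_rel_def by blast
  have "g - lin a b = lin a b ** (k - mat 1)" by (simp add: g matrix_diff_ldistrib)
  then have "mat_dvd (p ^ l) (g - lin a b)"
    using g(2) by (simp add: congruence_subgroup_iff mat_dvd_mult_left)
  then show "g \<in> GL \<and> (\<exists>a b. mat_dvd (p ^ l) (g - lin a b))"
    using g by (auto simp: congruence_subgroup_iff intro!: GL_mult)
next
  assume "g \<in> GL \<and> (\<exists>a b. mat_dvd (p ^ l) (g - lin a b))"
  then obtain a b where g: "g \<in> GL" and ab: "mat_dvd (p ^ l) (g - lin a b)" by blast
  have p: "mat_dvd p (g - lin a b)"
    using ab p_dvd_p_pow[OF l_pos] unfolding mat_dvd_def by (meson dvd_trans)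
  have "primitive a b"
  proof
    assume ab: "p dvd a \<and> p dvd b"
    then have "mat_dvd p (lin a b)"
      by (simp add: mat_dvd_def forall_2)
    then have "mat_dvd p (g - lin a b + lin a b)" using p mat_dvd_add by blast
    then have "p dvd det g" by (simp add: mat_dvd_def det_2)
    then show False using g GL_2_iff unit_iff by blast
  qed
  then have s: "lin a b \<in> GL" using lin_GL_iff by blast
  then obtain c d where s': "lin a b ** lin c d = mat 1" "lin c d ** lin a b = mat 1" "lin c d \<in> GL"
    using lin_inverse by metis
  define k where "k = lin c d ** g"
  have "k - mat 1 = lin c d ** (g - lin a b)" by (simp add: k_def s' matrix_diff_ldistrib)
  then have "k \<in> K"
    using ab g s' by (simp add: congruence_subgroup_iff mat_dvd_mult_left k_def GL_mult)
  moreover have "g = lin a b ** k" by (simp add: k_def matrix_mul_assoc s')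
  ultimately show "g \<in> box_group" using box_relI[OF s] unfolding box_group_def by blast
qed

text \<open>
  The first row of an element is an arbitrary primitive vector, and it determines the second row
  modulo \<open>p ^ l\<close>.  The two free choices in the ideal generated by \<open>p ^ l\<close> together
  contribute the cardinality of the ring, since \<open>r = 2 l\<close>.
\<close>

lemma card_box_group: "card box_group = card {(a, b). primitive a b} * card (UNIV :: 'a set)"
proof -
  let ?I = "{x. p ^ l dvd x}"
  define f where "f = (\<lambda>((a, b), y, z). mat2 a b (- nm * b + y) (a + tr * b + z))"
  let ?D = "{(a, b). primitive a b} \<times> ?I \<times> ?I"
  have mem: "mat2 a b (- nm * b + y) (a + tr * b + z) \<in> box_group \<longleftrightarrow> primitive a b"
    if "p ^ l dvd y" "p ^ l dvd z" for a b y z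
  proof -
    let ?g = "mat2 a b (- nm * b + y) (a + tr * b + z)"
    have "mat_dvd (p ^ l) (?g - lin a b)"
      using that by (simp add: mat_dvd_def forall_2)
    moreover have "?g \<in> GL \<longleftrightarrow> lin a b \<in> GL"
    proof -
      have "p dvd y" "p dvd z" using that p_dvd_p_pow[OF l_pos] dvd_trans by blast+
      then have "p dvd a * z - b * y" by simp
      moreover have "det ?g = det (lin a b) + (a * z - b * y)"
        by (simp add: det_2 algebra_simps)
      ultimately show ?thesis unfolding GL_2_iff unit_iff by (metis dvd_add_left_iff)
    qed
    ultimately show ?thesis using box_group_iff lin_GL_iff by blast
  qed
  have "bij_betw f ?D box_group"
    unfolding bij_betw_def
  proof
    show "inj_on f ?D"
    proof (rule inj_onI)
      fix X Y assume XY: "X \<in> ?D" "Y \<in> ?D" "f X = f Y"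
      obtain a b y z a' b' y' z' where X: "X = ((a, b), y, z)" and Y: "Y = ((a', b'), y', z')"
        by (metis surj_pair)
      have eq: "mat2 a b (- nm * b + y) (a + tr * b + z) = mat2 a' b' (- nm * b' + y') (a' + tr * b' + z')"
        using XY(3) by (simp add: X Y f_def)
      have "a = a'" "b = b'" using arg_cong[OF eq, of "\<lambda>A. A $ 1 $ 1"] arg_cong[OF eq, of "\<lambda>A. A $ 1 $ 2"] by simp_all
      moreover from this have "y = y'" "z = z'"
        using arg_cong[OF eq, of "\<lambda>A. A $ 2 $ 1"] arg_cong[OF eq, of "\<lambda>A. A $ 2 $ 2"] by simp_all
      ultimately show "X = Y" by (simp add: X Y)
    qed
    show "f ` ?D = box_group"
    proof
      show "f ` ?D \<subseteq> box_group"
      proof (rule image_subsetI)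
        fix X assume "X \<in> ?D"
        then obtain a b y z where "X = ((a, b), y, z)" "primitive a b" "p ^ l dvd y" "p ^ l dvd z"
          by blast
        then show "f X \<in> box_group" using mem by (simp add: f_def)
      qed
      show "box_group \<subseteq> f ` ?D"
      proof
        fix g assume g: "g \<in> box_group"
        then obtain a b where "mat_dvd (p ^ l) (g - lin a b)" using box_group_iff by blast
        then have d: "p ^ l dvd (g - lin a b) $ i $ j" for i j by (simp add: mat_dvd_def)
        define a' b' where "a' = g $ 1 $ 1" and "b' = g $ 1 $ 2"
        have ab: "p ^ l dvd a' - a" "p ^ l dvd b' - b" "p ^ l dvd g $ 2 $ 1 + nm * b" "p ^ l dvd g $ 2 $ 2 - (a + tr * b)"
          using d[of 1 1] d[of 1 2] d[of 2 1] d[of 2 2] by (simp_all add: a'_def b'_def)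
        define y z where "y = g $ 2 $ 1 + nm * b'" and "z = g $ 2 $ 2 - (a' + tr * b')"
        have "y = (g $ 2 $ 1 + nm * b) + nm * (b' - b)" "z = (g $ 2 $ 2 - (a + tr * b)) - (a' - a) - tr * (b' - b)"
          by (simp_all add: y_def z_def algebra_simps)
        then have yz: "p ^ l dvd y" "p ^ l dvd z" using ab by (metis dvd_add dvd_mult, metis dvd_diff dvd_mult)
        have gm: "g = mat2 a' b' (- nm * b' + y) (a' + tr * b' + z)"
          by (rule mat2_eqI) (simp_all add: y_def z_def a'_def b'_def)
        then have "primitive a' b'" using mem[OF yz] g by simp
        then have "((a', b'), y, z) \<in> ?D" using yz by blast
        moreover have "g = f ((a', b'), y, z)" using gm by (simp add: f_def)
        ultimately show "g \<in> f ` ?D" by blast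
      qed
    qed
  qed
  then have "card box_group = card ?D" using bij_betw_same_card by metis
  also have "\<dots> = card {(a, b). primitive a b} * (card ?I * card ?I)"
    by (simp add: card_cartesian_product)
  also have "card ?I * card ?I = card (UNIV :: 'a set)"
    using card_ideal[of l] card_ideal[of 0] by (simp add: r_eq power_add[symmetric] mult_2)
  finally show ?thesis .
qed

lemma psi_multiple_level:
  assumes "u dvd 1"
  shows "(\<Sum>x\<in>UNIV. \<psi> (p ^ (r - 1) * (x * u))) = 0"
proof -
  obtain x0 where x0: "\<psi> (p ^ (r - 1) * x0) \<noteq> 1" using psi_level by blast
  obtain v where "1 = u * v" using assms by (rule dvdE)
  then have "(x0 * v) * u = x0" by (simp add: mult.assoc mult.commute[of v u])
  then have "\<psi> (p ^ (r - 1) * ((x0 * v) * u)) \<noteq> 1" using x0 by simp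
  then show ?thesis
    by (rule sum_additive_character_eq_0[rotated]) (simp add: psi_add[symmetric] algebra_simps)
qed

text \<open>
  The sum over the whole ring vanishes, and each nonunit contributes 1 because \<open>\<psi>\<close> is
  only evaluated on multiples of \<open>p ^ (r - 1)\<close>.
\<close>

lemma psi_sum_units:
  assumes "u dvd 1"
  shows "(\<Sum>v | v dvd 1. \<psi> (p ^ (r - 1) * (v * u))) = - of_nat (card {x. p dvd x})"
proof -
  let ?f = "\<lambda>v. \<psi> (p ^ (r - 1) * (v * u))"
  have "(\<Sum>v\<in>UNIV. ?f v) = (\<Sum>v | v dvd 1. ?f v) + (\<Sum>v | \<not> v dvd 1. ?f v)"
    by (subst sum.union_disjoint[symmetric]) (auto intro!: sum.cong)
  moreover have "?f v = 1" if "\<not> v dvd 1" for v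
  proof -
    have "p dvd v" using that unit_iff by blast
    then obtain w where "v = p * w" by (rule dvdE)
    then have "p ^ (r - 1) * (v * u) = p ^ Suc (r - 1) * (w * u)"
      by (simp only: power_Suc2 mult.assoc)
    then show ?thesis using p_pow_r r_pos psi_0 by simp
  qed
  then have "(\<Sum>v | \<not> v dvd 1. ?f v) = of_nat (card {x. p dvd x})"
    using unit_iff by simp
  ultimately show ?thesis using psi_multiple_level[OF assms] by (simp add: add_eq_0_iff)
qed

text \<open>
  The value of \<open>\<psi>\<close> that the congruence part of \<open>x B x\<^sup>-\<^sup>1\<close> contributes;
  \<open>\<alpha>'\<close> stands for the inverse of the diagonal entry \<open>\<alpha>\<close> of \<open>B\<close>.
\<close>

definition weight :: "nat \<Rightarrow> 'a \<Rightarrow> 'a \<Rightarrow> 'a ^ 2 ^ 2 \<Rightarrow> complex" where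
  "weight i \<alpha>' \<beta>' x = \<psi> (\<alpha>' * (p ^ i * conj_beta x $ 1 $ 2 + p ^ (i + 1) * \<beta>' * conj_beta x $ 2 $ 1))"

lemma conj_beta_diag:
  assumes "x \<in> GL" and vw: "v * w = 1"
  shows "conj_beta (x ** mat2 1 0 0 v) $ 1 $ 2 = v * conj_beta x $ 1 $ 2"
    "conj_beta (x ** mat2 1 0 0 v) $ 2 $ 1 = w * conj_beta x $ 2 $ 1"
    "x ** mat2 1 0 0 v \<in> GL"
proof -
  define D D' where "D = mat2 1 0 0 v" and "D' = mat2 1 0 0 w"
  have D: "D ** D' = mat 1" "D' ** D = mat 1"
    using vw by (auto intro!: mat2_eqI simp: D_def D'_def mat2_simps mult.commute)
  then have DG: "D \<in> GL" unfolding GL_def invertible_def by blast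
  then show xD: "x ** mat2 1 0 0 v \<in> GL" using assms GL_mult D_def by blast
  have "(D' ** matrix_inv x) ** (x ** D) = D' ** (matrix_inv x ** x) ** D"
    by (simp add: matrix_mul_assoc)
  also have "\<dots> = mat 1" using GL_inverse[OF assms(1)] D by simp
  finally have "(D' ** matrix_inv x) ** ((x ** D) ** matrix_inv (x ** D)) = matrix_inv (x ** D)"
    by (simp only: matrix_mul_assoc matrix_mul_lid)
  then have inv: "matrix_inv (x ** D) = D' ** matrix_inv x"
    using GL_inverse[OF xD] by (simp add: D_def)
  have cb: "conj_beta (x ** D) = D' ** conj_beta x ** D"
    unfolding conj_beta_def inv by (simp add: matrix_mul_assoc)
  show "conj_beta (x ** mat2 1 0 0 v) $ 1 $ 2 = v * conj_beta x $ 1 $ 2"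
    "conj_beta (x ** mat2 1 0 0 v) $ 2 $ 1 = w * conj_beta x $ 2 $ 1"
    using cb by (simp_all add: D_def D'_def mat2_simps mult.commute)
qed

lemma sum_GL_diag:
  fixes F :: "'a ^ 2 ^ 2 \<Rightarrow> complex"
  assumes "v dvd 1"
  shows "(\<Sum>x\<in>GL. F (x ** mat2 1 0 0 v)) = (\<Sum>x\<in>GL. F x)"
proof -
  obtain w where vw: "v * w = 1" using assms by (metis dvdE)
  have D: "mat2 1 0 0 v ** mat2 1 0 0 w = mat 1" "mat2 1 0 0 w ** mat2 1 0 0 v = mat 1"
    using vw by (auto intro!: mat2_eqI simp: mat2_simps mult.commute)
  have wv: "w * v = 1" using vw by (simp add: mult.commute)
  show ?thesis
    by (rule sum.reindex_bij_witness[of _ "\<lambda>x. x ** mat2 1 0 0 w" "\<lambda>x. x ** mat2 1 0 0 v"])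
      (use D conj_beta_diag(3)[where v = v and w = w] conj_beta_diag(3)[where v = w and w = v] vw wv
        in \<open>simp_all add: matrix_mul_assoc[symmetric]\<close>)
qed

text \<open>
  Right translation by \<open>diag(1, v)\<close> with \<open>v = 1 + p ^ (r - 1 - i) * s\<close> multiplies the
  weight by a character value that depends on \<open>s\<close> through \<open>p ^ (r - 1)\<close> times a unit.
  Summing over \<open>s\<close> gives 0.
\<close>

lemma sum_weight_below:
  assumes i: "i < r - 1" and \<alpha>': "\<alpha>' dvd 1"
  shows "(\<Sum>x\<in>GL. weight i \<alpha>' \<beta>' x) = 0"
proof -
  define m where "m = r - 1 - i"
  have m: "0 < m" "i + m = r - 1" using i by (auto simp: m_def)
  define v where "v s = 1 + p ^ m * s" for s
  have v: "v s dvd 1" for s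
  proof -
    have "p dvd p ^ m * s" using p_dvd_p_pow[OF m(1)] by simp
    then have "\<not> p dvd v s" unfolding v_def using unit_iff[of 1] dvd_add_left_iff by auto
    then show ?thesis using unit_iff by blast
  qed
  have step: "weight i \<alpha>' \<beta>' (x ** mat2 1 0 0 (v s)) =
      weight i \<alpha>' \<beta>' x * \<psi> (p ^ (r - 1) * (s * (\<alpha>' * conj_beta x $ 1 $ 2)))" if x: "x \<in> GL" for x s
  proof -
    obtain w where w: "v s * w = 1" using v by (metis dvdE)
    \<comment> \<open>the entry below the diagonal does not feel \<open>w\<close>, since \<open>p ^ (i + 1) * (w - 1) = 0\<close>\<close>
    have "w = 1 - p ^ m * s * w" using w by (simp add: v_def algebra_simps)
    then have "p ^ (i + 1) * w = p ^ (i + 1) * (1 - p ^ m * s * w)" by simp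
    also have "\<dots> = p ^ (i + 1) - p ^ (i + 1 + m) * s * w"
      by (simp only: power_add right_diff_distrib mult_1_right mult.assoc)
    also have "p ^ (i + 1 + m) = 0" by (rule p_pow_eq_0) (use m r_pos in simp)
    finally have pw: "p ^ (i + 1) * w = p ^ (i + 1)" by simp
    note d = conj_beta_diag[OF x w]
    have "p ^ i * (v s * conj_beta x $ 1 $ 2) = p ^ i * conj_beta x $ 1 $ 2 + p ^ (r - 1) * (s * conj_beta x $ 1 $ 2)"
      unfolding m(2)[symmetric] by (simp add: v_def algebra_simps power_add)
    moreover have "p ^ (i + 1) * \<beta>' * (w * conj_beta x $ 2 $ 1) = p ^ (i + 1) * \<beta>' * conj_beta x $ 2 $ 1"
      using pw by (metis (no_types, opaque_lifting) mult.assoc mult.commute)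
    ultimately show ?thesis
      unfolding weight_def d psi_add[symmetric] by (simp add: algebra_simps)
  qed
  have "of_nat (card (UNIV :: 'a set)) * (\<Sum>x\<in>GL. weight i \<alpha>' \<beta>' x)
      = (\<Sum>s\<in>UNIV. \<Sum>x\<in>GL. weight i \<alpha>' \<beta>' (x ** mat2 1 0 0 (v s)))"
    by (simp add: sum_GL_diag[OF v, of "weight i \<alpha>' \<beta>'"])
  also have "\<dots> = (\<Sum>x\<in>GL. weight i \<alpha>' \<beta>' x * (\<Sum>s\<in>UNIV. \<psi> (p ^ (r - 1) * (s * (\<alpha>' * conj_beta x $ 1 $ 2)))))"
    by (subst sum.swap) (simp add: step sum_distrib_left)
  also have "\<dots> = 0"
    by (intro sum.neutral) (metis psi_multiple_level unit_mult conj_beta_entry_unit \<alpha>' mult_zero_right)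
  finally show ?thesis by simp
qed

text \<open>
  Only the entry above the diagonal matters for \<open>i = r - 1\<close>, and averaging over
  \<open>diag(1, v)\<close> for all units \<open>v\<close> replaces each summand by the same constant.
\<close>

lemma sum_weight_top:
  assumes \<alpha>': "\<alpha>' dvd 1"
  shows "(\<Sum>x\<in>GL. weight (r - 1) \<alpha>' \<beta>' x) = - of_nat (card box_group * card {x. p dvd x})"
proof -
  let ?U = "{v. v dvd (1::'a)}"
  have p0: "p ^ (r - 1 + 1) = 0" by (rule p_pow_eq_0) simp
  have step: "weight (r - 1) \<alpha>' \<beta>' (x ** mat2 1 0 0 v) = \<psi> (p ^ (r - 1) * (v * (\<alpha>' * conj_beta x $ 1 $ 2)))"
    if x: "x \<in> GL" and v: "v \<in> ?U" for x v
  proof -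
    obtain w where w: "v * w = 1" using v by (metis dvdE mem_Collect_eq)
    show ?thesis unfolding weight_def conj_beta_diag[OF x w] p0 by (simp add: algebra_simps)
  qed
  have "of_nat (card ?U) * (\<Sum>x\<in>GL. weight (r - 1) \<alpha>' \<beta>' x)
      = (\<Sum>v\<in>?U. \<Sum>x\<in>GL. weight (r - 1) \<alpha>' \<beta>' (x ** mat2 1 0 0 v))"
    using sum_GL_diag[of _ "weight (r - 1) \<alpha>' \<beta>'"] by simp
  also have "\<dots> = (\<Sum>x\<in>GL. \<Sum>v\<in>?U. \<psi> (p ^ (r - 1) * (v * (\<alpha>' * conj_beta x $ 1 $ 2))))"
    by (subst sum.swap) (intro sum.cong refl step)
  also have "\<dots> = (\<Sum>x\<in>(GL :: ('a ^ 2 ^ 2) set). - of_nat (card {x. p dvd x}))"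
    by (intro sum.cong refl psi_sum_units unit_mult conj_beta_entry_unit \<alpha>')
  also have "\<dots> = of_nat (card ?U) * - of_nat (card box_group * card {x. p dvd x})"
    by (simp add: card_GL card_box_group)
  finally show ?thesis
    using card_units by (simp only: mult_cancel_left of_nat_eq_0_iff) simp
qed

text \<open>
  Conjugating back, membership says that \<open>B\<close> is congruent to a combination
  \<open>a + b \<gamma>\<close> with \<open>\<gamma> = conj_beta x\<close>.  As \<open>\<gamma>\<^sub>1\<^sub>2\<close> is a unit, the
  entries off the diagonal make \<open>b\<close>, and then \<open>p ^ i\<close>, divisible by \<open>p ^ (i + 1)\<close>.
\<close>

lemma not_conj_mem_box_group:
  assumes i: "i < l" and x: "x \<in> GL"
  shows "x ** mat2 \<alpha> (p ^ (i + 1) * \<beta>') (p ^ i) \<alpha> ** matrix_inv x \<notin> box_group"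
proof
  let ?B = "mat2 \<alpha> (p ^ (i + 1) * \<beta>') (p ^ i) \<alpha>"
  assume "x ** ?B ** matrix_inv x \<in> box_group"
  then obtain a b where "mat_dvd (p ^ l) (x ** ?B ** matrix_inv x - lin a b)"
    using box_group_iff by blast
  then have "mat_dvd (p ^ l) (matrix_inv x ** (x ** ?B ** matrix_inv x - lin a b) ** x)"
    by (rule mat_dvd_mult_right[OF mat_dvd_mult_left])
  also have "matrix_inv x ** (x ** ?B ** matrix_inv x - lin a b) ** x
      = (matrix_inv x ** x) ** ?B ** (matrix_inv x ** x) - matrix_inv x ** lin a b ** x"
    by (simp add: matrix_diff_ldistrib matrix_diff_rdistrib matrix_mul_assoc)
  also have "matrix_inv x ** lin a b ** x = mat a + mat b ** conj_beta x"
  proof -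
    have comm: "matrix_inv x ** mat c = mat c ** matrix_inv x" for c
      by (rule mat2_eqI) (simp_all add: mat2_simps)
    have "matrix_inv x ** lin a b ** x = mat a ** (matrix_inv x ** x) + mat b ** conj_beta x"
      unfolding lin_def conj_beta_def
      by (simp add: matrix_add_ldistrib matrix_add_rdistrib matrix_mul_assoc comm)
    then show ?thesis by (simp add: GL_inverse[OF x])
  qed
  finally have d: "p ^ l dvd (?B - (mat a + mat b ** conj_beta x)) $ i $ j" for i j
    by (simp add: GL_inverse[OF x] mat_dvd_def)
  have il: "p ^ (i + 1) dvd p ^ l" using i by (intro le_imp_power_dvd) simp
  have "p ^ (i + 1) dvd p ^ (i + 1) * \<beta>' - b * conj_beta x $ 1 $ 2"
    using dvd_trans[OF il d[of 1 2]] by (simp add: mat2_simps)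
  then have "p ^ (i + 1) dvd p ^ (i + 1) * \<beta>' - (p ^ (i + 1) * \<beta>' - b * conj_beta x $ 1 $ 2)"
    by (rule dvd_diff[OF dvd_triv_left])
  then have b\<gamma>: "p ^ (i + 1) dvd b * conj_beta x $ 1 $ 2"
    by (simp only: diff_diff_eq2 add_diff_cancel_left')
  obtain w where "1 = conj_beta x $ 1 $ 2 * w" using conj_beta_entry_unit[OF x] by (rule dvdE)
  then have "b = b * conj_beta x $ 1 $ 2 * w" by (simp add: mult.assoc)
  then have b: "p ^ (i + 1) dvd b" using b\<gamma> dvd_mult2 by metis
  have "p ^ (i + 1) dvd p ^ i - b * conj_beta x $ 2 $ 1"
    using dvd_trans[OF il d[of 2 1]] by (simp add: mat2_simps)
  then have "p ^ (i + 1) dvd (p ^ i - b * conj_beta x $ 2 $ 1) + b * conj_beta x $ 2 $ 1"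
    using b by (intro dvd_add dvd_mult2)
  then have "p ^ (i + 1) dvd p ^ i" by simp
  then show False using not_p_pow_Suc_dvd[of i] i r_eq by simp
qed

lemma box_conj:
  assumes i: "l \<le> i" and x: "x \<in> GL" and \<alpha>: "\<alpha>' * \<alpha> = 1"
  shows "box_rel (x ** mat2 \<alpha> (p ^ (i + 1) * \<beta>') (p ^ i) \<alpha> ** matrix_inv x) (\<theta> \<alpha> 0 * weight i \<alpha>' \<beta>' x)"
proof -
  let ?B = "mat2 \<alpha> (p ^ (i + 1) * \<beta>') (p ^ i) \<alpha>"
  define Y where "Y = mat2 0 (\<alpha>' * (p ^ (i + 1) * \<beta>')) (\<alpha>' * p ^ i) 0"
  define k where "k = mat 1 + x ** Y ** matrix_inv x"
  have B: "?B = mat \<alpha> + mat \<alpha> ** Y"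
    using \<alpha> by (auto intro!: mat2_eqI simp: Y_def mat2_simps mult.assoc[symmetric] mult.commute[of \<alpha> \<alpha>'])
  have comm: "x ** mat c = mat c ** x" for c
    by (rule mat2_eqI) (simp_all add: mat2_simps mult.commute)
  have eq: "x ** ?B ** matrix_inv x = lin \<alpha> 0 ** k"
  proof -
    have "x ** ?B ** matrix_inv x = mat \<alpha> ** (x ** matrix_inv x) + mat \<alpha> ** (x ** Y ** matrix_inv x)"
      unfolding B by (simp add: matrix_add_ldistrib matrix_add_rdistrib matrix_mul_assoc comm)
    then show ?thesis
      by (simp add: GL_inverse[OF x] k_def matrix_add_ldistrib lin_scalar)
  qed
  have "\<alpha> dvd 1" using \<alpha> by (metis dvd_triv_right)
  then have s: "lin \<alpha> 0 \<in> GL" by (simp add: lin_GL_iff unit_iff)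
  have li: "p ^ l dvd p ^ i" "p ^ l dvd p ^ (i + 1)" 
    using le_imp_power_dvd[of l i p] le_imp_power_dvd[of l "i + 1" p] i by simp_all
  have "mat_dvd (p ^ l) Y"
    using li by (auto simp: mat_dvd_def forall_2 Y_def)
  then have dY: "mat_dvd (p ^ l) (x ** Y ** matrix_inv x)"
    by (rule mat_dvd_mult_right[OF mat_dvd_mult_left])
  have "p dvd det k - 1"
  proof -
    have "p dvd (x ** Y ** matrix_inv x) $ i $ j" for i j
      using dY p_dvd_p_pow[OF l_pos] dvd_trans unfolding mat_dvd_def by blast
    then show ?thesis
      by (simp add: k_def det_2 algebra_simps)
  qed
  then have "k \<in> GL" unfolding GL_2_iff unit_iff using unit_iff[of 1]
    by (metis dvd_diff_right_iff dvd_refl)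
  then have k: "k \<in> K" using dY by (simp add: congruence_subgroup_iff k_def)
  have "trace (\<beta> ** (k - mat 1)) = trace ((\<beta> ** x ** Y) ** matrix_inv x)"
    by (simp add: k_def matrix_mul_assoc)
  also have "\<dots> = trace (matrix_inv x ** (\<beta> ** x ** Y))" by (rule trace_mul_sym)
  also have "\<dots> = trace (conj_beta x ** Y)" by (simp add: conj_beta_def matrix_mul_assoc)
  also have "\<dots> = \<alpha>' * (p ^ i * conj_beta x $ 1 $ 2 + p ^ (i + 1) * \<beta>' * conj_beta x $ 2 $ 1)"
    by (simp add: mat2_simps Y_def algebra_simps)
  finally show ?thesis
    using box_relI[OF s k] unfolding eq weight_def by simp
qed

text \<open>
  Frobenius's formula has no nonzero summand for \<open>i < l\<close> and reduces to the sum of the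
  weights otherwise.  The number of nonunits is \<open>q\<^sup>r\<^sup>-\<^sup>1\<close> for a truncation of order
  \<open>r\<close>.
\<close>

theorem induced_character_value:
  assumes i: "i \<le> r - 1" and \<alpha>: "\<alpha> dvd 1"
  shows "induced_character (group_T l p \<beta>) box_char (mat2 \<alpha> (p ^ (i + 1) * \<beta>') (p ^ i) \<alpha>) =
    - (of_bool (i = r - 1) * \<theta> \<alpha> 0 * of_nat (card {x. p dvd x}))"
proof -
  let ?B = "mat2 \<alpha> (p ^ (i + 1) * \<beta>') (p ^ i) \<alpha>"
  let ?c = "\<lambda>x. x ** ?B ** matrix_inv x"
  obtain \<alpha>' where \<alpha>': "\<alpha>' * \<alpha> = 1" using \<alpha> by (metis dvdE mult.commute)
  have \<alpha>'u: "\<alpha>' dvd 1" using \<alpha>' by (metis dvd_triv_left)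
  have "p dvd p ^ (i + 1) * \<beta>' * p ^ i" by simp
  moreover have "\<not> p dvd \<alpha> * \<alpha>" using unit_mult[OF \<alpha> \<alpha>] unit_iff by blast
  moreover have "\<alpha> * \<alpha> = det ?B + p ^ (i + 1) * \<beta>' * p ^ i" by (simp add: det_2)
  ultimately have "\<not> p dvd det ?B" using dvd_add by metis
  then have B: "?B \<in> GL" unfolding GL_2_iff using unit_iff by blast
  have char: "induced_character box_group box_char ?B = (\<Sum>x\<in>GL. if ?c x \<in> box_group then box_char (?c x) else 0) / of_nat (card box_group)"
    by (rule induced_character_eq_sum) (use box_group_character B in auto)
  show ?thesis
  proof (cases "i < l")
    case True
    then have "(\<Sum>x\<in>GL. if ?c x \<in> box_group then box_char (?c x) else 0) = 0"
      using not_conj_mem_box_group by (intro sum.neutral) auto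
    moreover have "i \<noteq> r - 1" using True r_eq l_pos by simp
    ultimately show ?thesis using char box_group_eq by simp
  next
    case False
    then have "box_rel (?c x) (\<theta> \<alpha> 0 * weight i \<alpha>' \<beta>' x)" if "x \<in> GL" for x
      using box_conj[OF _ that \<alpha>'] by simp
    then have "(\<Sum>x\<in>GL. if ?c x \<in> box_group then box_char (?c x) else 0) = (\<Sum>x\<in>GL. \<theta> \<alpha> 0 * weight i \<alpha>' \<beta>' x)"
      using box_char_eq by (intro sum.cong refl) (auto simp: box_group_def)
    then have eq: "induced_character box_group box_char ?B = \<theta> \<alpha> 0 * (\<Sum>x\<in>GL. weight i \<alpha>' \<beta>' x) / of_nat (card box_group)"
      unfolding char by (simp add: sum_distrib_left)
    have "card box_group \<noteq> 0" using box_group_character(2) finite[of box_group] card_0_eq by blast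
    then show ?thesis
      using eq sum_weight_top[OF \<alpha>'u, of \<beta>'] sum_weight_below[OF _ \<alpha>'u, of i \<beta>'] i
      by (cases "i = r - 1") (simp_all add: box_group_eq)
  qed
qed

end

section \<open>Truncations of the ring of integers\<close>

context discrete_valued_field
begin

lemma val_power: "x \<noteq> 0 \<Longrightarrow> val (x ^ n) = int n * val x"
  by (induction n) (simp_all add: val_mult algebra_simps)

lemma val_ge_mono: "val_ge k x \<Longrightarrow> j \<le> k \<Longrightarrow> val_ge j x"
  by (auto simp: val_ge_def)

lemma val_ge_mult_integral: "val_ge 0 x \<Longrightarrow> val_ge k y \<Longrightarrow> val_ge k (x * y)"
  using val_ge_mult[of 0 x k y] by simp

lemma val_ge_0_power: "val_ge 0 x \<Longrightarrow> val_ge 0 (x ^ n)"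
  by (induction n) (simp_all add: val_ge_mult_integral)

lemma val_inverse: "x \<noteq> 0 \<Longrightarrow> val (inverse x) = - val x"
  using val_mult[of x "inverse x"] by simp

lemma eq_0_if_val_ge: "(\<And>k. val_ge (int k) x) \<Longrightarrow> x = 0"
proof (rule ccontr)
  assume "\<And>k. val_ge (int k) x" "x \<noteq> 0"
  then have "int (nat (val x + 1)) \<le> val x" by (metis val_ge_def)
  then show False by linarith
qed

end

text \<open>
  The powers of the maximal ideal are generated by the powers of a uniformizer.
\<close>

lemma val_ge_iff_uniformizer:
  assumes "uniformizer \<pi>"
  shows "val_ge (int n) x \<longleftrightarrow> (\<exists>y. val_ge 0 y \<and> x = \<pi> ^ n * y)"
proof
  have \<pi>: "\<pi> \<noteq> 0" "val \<pi> = 1" using assms by (auto simp: uniformizer_def)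
  { assume "val_ge (int n) x"
    moreover have "val x = val (x / \<pi> ^ n) + int n" if "x \<noteq> 0"
      using val_mult[of "x / \<pi> ^ n" "\<pi> ^ n"] \<pi> that by (simp add: val_power)
    ultimately have "val_ge 0 (x / \<pi> ^ n)" by (auto simp: val_ge_def)
    moreover have "x = \<pi> ^ n * (x / \<pi> ^ n)" using \<pi> by simp
    ultimately show "\<exists>y. val_ge 0 y \<and> x = \<pi> ^ n * y" by blast }
  assume "\<exists>y. val_ge 0 y \<and> x = \<pi> ^ n * y"
  then obtain y where y: "val_ge 0 y" "x = \<pi> ^ n * y" by blast
  have "val_ge (int n) (\<pi> ^ n)" using \<pi> by (simp add: val_ge_def val_power)
  then show "val_ge (int n) x" unfolding y(2) using val_ge_mult[OF _ y(1)] by fastforce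
qed

lemma integers_closed:
  "x \<in> integers \<Longrightarrow> y \<in> integers \<Longrightarrow> x + y \<in> integers"
  "x \<in> integers \<Longrightarrow> y \<in> integers \<Longrightarrow> x - y \<in> integers"
  "x \<in> integers \<Longrightarrow> y \<in> integers \<Longrightarrow> x * y \<in> integers"
  "x \<in> integers \<Longrightarrow> x ^ n \<in> integers"
  "0 \<in> integers" "1 \<in> integers"
  for x y :: "'a::discrete_valued_field"
  by (simp_all add: integers_def val_ge_add val_ge_diff val_ge_mult_integral val_ge_0_power)

lemma uniformizer_integer: "uniformizer \<pi> \<Longrightarrow> \<pi> \<in> integers"
  by (simp add: uniformizer_def integers_def val_ge_def)

lemma val_cong_refl: "val_cong n x x \<longleftrightarrow> x \<in> integers"
  by (simp add: val_cong_def)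

lemma abs_trunc_eq_iff:
  fixes x y :: "'a::discrete_valued_field"
  assumes "x \<in> integers" "y \<in> integers"
  shows "(abs_trunc x :: ('a, 'n::finite) trunc) = abs_trunc y \<longleftrightarrow> val_ge (int CARD('n)) (x - y)"
  using Quotient_rel[OF Quotient_trunc[where 'a = 'a and 'n = 'n], of x y] assms by (simp add: val_cong_def)

lemma rep_trunc_integer: "rep_trunc a \<in> integers"
  for a :: "('a::discrete_valued_field, 'n::finite) trunc"
  using Quotient_rep_reflp[OF Quotient_trunc, of a] by (simp add: val_cong_refl)

lemma abs_rep_trunc: "abs_trunc (rep_trunc a) = a"
  for a :: "('a::discrete_valued_field, 'n::finite) trunc"
  by (rule Quotient_abs_rep[OF Quotient_trunc])

lemma trunc_cases:
  fixes a :: "('a::discrete_valued_field, 'n::finite) trunc"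
  obtains x where "x \<in> integers" "a = abs_trunc x"
  using rep_trunc_integer abs_rep_trunc by metis

lemma abs_trunc_zero: "abs_trunc 0 = 0" and abs_trunc_one: "abs_trunc 1 = 1"
  by (simp_all add: zero_trunc.abs_eq one_trunc.abs_eq)

lemma abs_trunc_add:
  "x \<in> integers \<Longrightarrow> y \<in> integers \<Longrightarrow> abs_trunc (x + y) = abs_trunc x + abs_trunc y"
  by (simp add: plus_trunc.abs_eq val_cong_refl)

lemma abs_trunc_mult:
  "x \<in> integers \<Longrightarrow> y \<in> integers \<Longrightarrow> abs_trunc (x * y) = abs_trunc x * abs_trunc y"
  by (simp add: times_trunc.abs_eq val_cong_refl)

lemma abs_trunc_power: "x \<in> integers \<Longrightarrow> abs_trunc (x ^ n) = abs_trunc x ^ n"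
  by (induction n) (simp_all add: abs_trunc_one abs_trunc_mult integers_closed)

lemma abs_trunc_eq_0_iff:
  fixes x :: "'a::discrete_valued_field"
  assumes "x \<in> integers"
  shows "(abs_trunc x :: ('a, 'n::finite) trunc) = 0 \<longleftrightarrow> val_ge (int CARD('n)) x"
  using abs_trunc_eq_iff[of x 0, where 'n = 'n] assms by (simp add: abs_trunc_zero integers_closed)

lemma ex_finite_residue_representatives:
  "\<exists>D. finite D \<and> (\<forall>x\<in>integers. \<exists>d\<in>D. val_ge 1 (x - (d :: 'a::nonarch_local_field)))"
proof -
  let ?R = "{(x :: 'a, y). val_cong 1 x y}"
  let ?D = "(\<lambda>C. SOME d. d \<in> C) ` (integers // ?R)"
  have "\<exists>d\<in>?D. val_ge 1 (x - d)" if "x \<in> integers" for x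
  proof (rule bexI)
    have "x \<in> ?R `` {x}" using that by (simp add: val_cong_refl)
    then have "(SOME d. d \<in> ?R `` {x}) \<in> ?R `` {x}" by (rule someI)
    then have "val_cong 1 x (SOME d. d \<in> ?R `` {x})" by blast
    moreover have "val_ge 1 (x - d)" if "val_cong 1 x d" for d
      using that by (simp add: val_cong_def)
    ultimately show "val_ge 1 (x - (SOME d. d \<in> ?R `` {x}))" by blast
    show "(SOME d. d \<in> ?R `` {x}) \<in> ?D" by (intro imageI quotientI that)
  qed
  then show ?thesis using finite_residue_field by blast
qed

text \<open>
  The digits of an expansion in powers of a uniformizer can be taken from a finite set of
  representatives of the residue field.
\<close>

lemma ex_finite_representatives:
  "\<exists>A. finite A \<and> A \<subseteq> integers \<and> (\<forall>x\<in>integers. \<exists>a\<in>A. val_ge (int n) (x - (a :: 'a::nonarch_local_field)))"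
proof (induction n)
  case 0
  show ?case by (rule exI[of _ "{0}"]) (simp add: integers_def)
next
  case (Suc n)
  then obtain A where A: "finite A" "A \<subseteq> integers" "\<And>x. x \<in> integers \<Longrightarrow> \<exists>a\<in>A. val_ge (int n) (x - (a::'a))"
    by blast
  obtain D where D: "finite D" "\<And>x. x \<in> integers \<Longrightarrow> \<exists>d\<in>D. val_ge 1 (x - (d :: 'a))"
    using ex_finite_residue_representatives by blast
  obtain \<pi> :: 'a where \<pi>: "uniformizer \<pi>" using val_normalised by (auto simp: uniformizer_def)
  let ?A = "(\<lambda>(d, a). d + \<pi> * a) ` (D \<times> A) \<inter> integers"
  have "\<exists>b\<in>?A. val_ge (int (Suc n)) (x - b)" if x: "x \<in> integers" for x
  proof -
    obtain d where d: "d \<in> D" "val_ge 1 (x - d)" using D(2) x by blast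
    then obtain y where y: "val_ge 0 y" "x - d = \<pi> * y"
      using val_ge_iff_uniformizer[OF \<pi>, of 1 "x - d"] by auto
    then obtain a where a: "a \<in> A" "val_ge (int n) (y - a)" using A(3)[of y] by (auto simp: integers_def)
    then obtain z where z: "val_ge 0 z" "y - a = \<pi> ^ n * z"
      using val_ge_iff_uniformizer[OF \<pi>] by blast
    have "x - (d + \<pi> * a) = \<pi> * (y - a)" using y by (simp add: algebra_simps)
    also have "\<dots> = \<pi> ^ Suc n * z" using z by simp
    finally have xz: "x - (d + \<pi> * a) = \<pi> ^ Suc n * z" .
    then have v: "val_ge (int (Suc n)) (x - (d + \<pi> * a))"
      using z val_ge_iff_uniformizer[OF \<pi>] by metis
    then have "val_ge 0 (x - (d + \<pi> * a))" by (rule val_ge_mono) simp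
    then have "val_ge 0 (d + \<pi> * a)"
      using val_ge_diff[of 0 x "x - (d + \<pi> * a)"] x by (simp add: integers_def)
    then have "d + \<pi> * a \<in> ?A" using d a by (auto simp: integers_def)
    then show ?thesis using v by blast
  qed
  moreover have "finite ?A" using A D by blast
  ultimately show ?case by blast
qed

instance trunc :: (nonarch_local_field, finite) finite
proof
  obtain A where A: "finite A" "A \<subseteq> integers" "\<And>x. x \<in> integers \<Longrightarrow> \<exists>a\<in>A. val_ge (int CARD('b)) (x - (a::'a))"
    using ex_finite_representatives[where 'a = 'a and n = "CARD('b)"] by metis
  have "c \<in> abs_trunc ` A" for c :: "('a, 'b) trunc"
  proof -
    obtain x where x: "x \<in> integers" "c = abs_trunc x" by (rule trunc_cases)
    obtain a where a: "a \<in> A" "val_ge (int CARD('b)) (x - a)" using A(3) x by blast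
    then have "c = abs_trunc a" using abs_trunc_eq_iff[of x a] x A(2) by auto
    then show ?thesis using a by blast
  qed
  then have "UNIV \<subseteq> (abs_trunc ` A :: ('a, 'b) trunc set)" by blast
  then show "finite (UNIV :: ('a, 'b) trunc set)" using A(1) finite_subset by blast
qed

lemma finite_chain_ring_trunc:
  fixes \<pi> :: "'f::nonarch_local_field"
  assumes "uniformizer \<pi>"
  shows "finite_chain_ring (abs_trunc \<pi> :: ('f, 'r::finite) trunc) CARD('r)"
proof
  have \<pi>: "\<pi> \<noteq> 0" "val \<pi> = 1" "\<pi> \<in> integers"
    using assms uniformizer_integer by (auto simp: uniformizer_def)
  have pow: "(abs_trunc \<pi> :: ('f, 'r) trunc) ^ n = 0 \<longleftrightarrow> CARD('r) \<le> n" for n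
    using abs_trunc_eq_0_iff[of "\<pi> ^ n", where 'n = 'r] \<pi>
    by (simp add: abs_trunc_power integers_closed val_ge_def val_power)
  show "(abs_trunc \<pi> :: ('f, 'r) trunc) ^ CARD('r) = 0" "(abs_trunc \<pi> :: ('f, 'r) trunc) ^ (CARD('r) - 1) \<noteq> 0"
    unfolding pow using zero_less_card_finite[where 'a = 'r] by linarith+
  fix x :: "('f, 'r) trunc"
  obtain y where y: "y \<in> integers" "x = abs_trunc y" by (rule trunc_cases)
  show "x dvd 1 \<or> abs_trunc \<pi> dvd x"
  proof (cases "val_ge (int 1) y")
    case True
    then obtain z where "val_ge 0 z" "y = \<pi> ^ 1 * z" using val_ge_iff_uniformizer[OF assms] by blast
    then have "x = abs_trunc \<pi> * abs_trunc z" using \<pi> y by (simp add: abs_trunc_mult integers_def)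
    then show ?thesis by simp
  next
    case False
    then have "y \<noteq> 0" "val y = 0" using y by (auto simp: val_ge_def integers_def)
    moreover from this have "inverse y \<in> integers" by (simp add: integers_def val_ge_def val_inverse)
    ultimately have "x * abs_trunc (inverse y) = 1"
      using y abs_trunc_mult[of y "inverse y"] by (simp add: abs_trunc_one)
    then show ?thesis by (metis dvd_triv_left)
  qed
qed

text \<open>
  Multiplication by \<open>\<pi>\<close> to the power \<open>r - 1\<close> identifies the residue field with the
  socle of the truncation.
\<close>

lemma abs_trunc_top_digit_eq_iff:
  fixes \<pi> x y :: "'f::discrete_valued_field"
  assumes "uniformizer \<pi>" and xy: "x \<in> integers" "y \<in> integers"
  shows "(abs_trunc (\<pi> ^ (CARD('r) - 1) * x) :: ('f, 'r::finite) trunc) = abs_trunc (\<pi> ^ (CARD('r) - 1) * y)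
    \<longleftrightarrow> (abs_trunc x :: ('f, 1) trunc) = abs_trunc y"
proof -
  define n where "n = CARD('r) - 1"
  have n: "int CARD('r) = int n + 1"
    unfolding n_def using zero_less_card_finite[where 'a = 'r] by linarith
  have \<pi>: "\<pi> \<noteq> 0" "val \<pi> = 1" "\<pi> \<in> integers"
    using assms(1) uniformizer_integer by (auto simp: uniformizer_def)
  have "val_ge (int n + 1) (\<pi> ^ n * (x - y)) \<longleftrightarrow> val_ge 1 (x - y)"
  proof (cases "x - y = 0")
    case False
    then have "val (\<pi> ^ n * (x - y)) = int n + val (x - y)"
      using \<pi> by (simp add: val_mult val_power)
    then show ?thesis unfolding val_ge_def using False \<pi> by simp
  qed simp
  moreover have "\<pi> ^ n * x - \<pi> ^ n * y = \<pi> ^ n * (x - y)"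
    by (simp add: right_diff_distrib)
  moreover have "\<pi> ^ n * x \<in> integers" "\<pi> ^ n * y \<in> integers"
    using \<pi> xy by (simp_all add: integers_closed)
  ultimately show ?thesis
    unfolding n_def[symmetric] using abs_trunc_eq_iff[OF xy, where 'n = 1]
      abs_trunc_eq_iff[of "\<pi> ^ n * x" "\<pi> ^ n * y", where 'n = 'r] n by simp
qed

lemma card_residue_field:
  fixes \<pi> :: "'f::nonarch_local_field"
  assumes "uniformizer \<pi>"
  shows "card {x :: ('f, 'r::finite) trunc. abs_trunc \<pi> ^ (CARD('r) - 1) dvd x} = CARD(('f, 1) trunc)"
proof -
  define n where "n = CARD('r) - 1"
  define f :: "('f, 1) trunc \<Rightarrow> ('f, 'r) trunc" where "f a = abs_trunc (\<pi> ^ n * rep_trunc a)" for a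
  have \<pi>: "\<pi> \<in> integers" using assms uniformizer_integer by blast
  have mult: "(abs_trunc (\<pi> ^ n * x) :: ('f, 'r) trunc) = abs_trunc \<pi> ^ n * abs_trunc x" if "x \<in> integers" for x
    using that \<pi> by (simp add: abs_trunc_mult abs_trunc_power integers_closed)
  note eq = abs_trunc_top_digit_eq_iff[OF assms, where 'r = 'r, folded n_def]
  have "inj f"
  proof (rule injI)
    fix a b assume "f a = f b"
    then show "a = b"
      using eq[OF rep_trunc_integer[of a] rep_trunc_integer[of b]] unfolding f_def by (simp only: abs_rep_trunc)
  qed
  moreover have "range f = {x. abs_trunc \<pi> ^ n dvd x}"
  proof (intro equalityI subsetI)
    fix x :: "('f, 'r) trunc" assume "x \<in> range f"
    then obtain a where "x = f a" by (rule rangeE)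
    then have "x = abs_trunc \<pi> ^ n * abs_trunc (rep_trunc a)"
      unfolding f_def using mult[OF rep_trunc_integer[of a]] by (rule trans)
    then show "x \<in> {x. abs_trunc \<pi> ^ n dvd x}" by simp
  next
    fix x :: "('f, 'r) trunc" assume "x \<in> {x. abs_trunc \<pi> ^ n dvd x}"
    then have "abs_trunc \<pi> ^ n dvd x" by simp
    then obtain y where y: "x = abs_trunc \<pi> ^ n * y" by (rule dvdE)
    obtain z where z: "z \<in> integers" "y = abs_trunc z" by (rule trunc_cases)
    have "x = abs_trunc (\<pi> ^ n * z)" using mult[OF z(1)] y z(2) by simp
    also have "\<dots> = f (abs_trunc z)" unfolding f_def
      by (subst eq[OF z(1) rep_trunc_integer]) (rule abs_rep_trunc[symmetric])
    finally show "x \<in> range f" by (rule range_eqI)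
  qed
  ultimately have "bij_betw f UNIV {x. abs_trunc \<pi> ^ n dvd x}" by (simp add: bij_betw_def)
  then show ?thesis unfolding n_def[symmetric] by (rule bij_betw_same_card[symmetric])
qed

section \<open>Maps between truncations\<close>

text \<open>
  Ring homomorphisms that are compatible with the filtrations by powers of the maximal ideals;
  these are the maps that induce homomorphisms of truncations.
\<close>

definition integral_hom :: "('a::discrete_valued_field \<Rightarrow> 'b::discrete_valued_field) \<Rightarrow> bool"
  where "integral_hom h \<longleftrightarrow> (\<forall>x y. h (x + y) = h x + h y) \<and> (\<forall>x y. h (x * y) = h x * h y) \<and> h 1 = 1 \<and>
    (\<forall>n x. val_ge (int n) x \<longrightarrow> val_ge (int n) (h x))"

context
  fixes h :: "'a::discrete_valued_field \<Rightarrow> 'b::discrete_valued_field"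
  assumes h: "integral_hom h"
begin

lemma integral_hom_add: "h (x + y) = h x + h y"
  and integral_hom_mult: "h (x * y) = h x * h y"
  and integral_hom_one: "h 1 = 1"
  and integral_hom_val_ge: "val_ge (int n) x \<Longrightarrow> val_ge (int n) (h x)"
  using h by (auto simp: integral_hom_def)

lemma integral_hom_zero: "h 0 = 0"
  using integral_hom_add[of 0 0] by (metis add_0 add_cancel_right_right)

lemma integral_hom_diff: "h (x - y) = h x - h y"
  using integral_hom_add[of "x - y" y] by simp

lemma integral_hom_integer: "x \<in> integers \<Longrightarrow> h x \<in> integers"
  using integral_hom_val_ge[of 0 x] by (simp add: integers_def)

lemma trunc_map_abs:
  assumes "x \<in> integers"
  shows "trunc_map h (abs_trunc x :: ('a, 'n::finite) trunc) = (abs_trunc (h x) :: ('b, 'n) trunc)"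
proof -
  let ?y = "rep_trunc (abs_trunc x :: ('a, 'n) trunc)"
  have y: "?y \<in> integers" by (rule rep_trunc_integer)
  have "val_ge (int CARD('n)) (?y - x)"
    using abs_trunc_eq_iff[OF y assms, where 'n = 'n] by (simp add: abs_rep_trunc)
  then have "val_ge (int CARD('n)) (h ?y - h x)"
    using integral_hom_val_ge integral_hom_diff by metis
  then show ?thesis
    unfolding trunc_map_def using abs_trunc_eq_iff[of "h ?y" "h x", where 'n = 'n] y assms
    by (simp add: integral_hom_integer)
qed

lemma trunc_map_add: "trunc_map h (a + b) = (trunc_map h a + trunc_map h b :: ('b, 'n::finite) trunc)"
  for a b :: "('a, 'n::finite) trunc"
proof -
  obtain x y where "x \<in> integers" "a = abs_trunc x" "y \<in> integers" "b = abs_trunc y"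
    by (metis trunc_cases)
  then show ?thesis
    by (simp add: trunc_map_abs abs_trunc_add[symmetric] integers_closed integral_hom_integer integral_hom_add)
qed

lemma trunc_map_mult: "trunc_map h (a * b) = (trunc_map h a * trunc_map h b :: ('b, 'n::finite) trunc)"
  for a b :: "('a, 'n::finite) trunc"
proof -
  obtain x y where "x \<in> integers" "a = abs_trunc x" "y \<in> integers" "b = abs_trunc y"
    by (metis trunc_cases)
  then show ?thesis
    by (simp add: trunc_map_abs abs_trunc_mult[symmetric] integers_closed integral_hom_integer integral_hom_mult)
qed

lemma trunc_map_one: "trunc_map h (1 :: ('a, 'n::finite) trunc) = (1 :: ('b, 'n) trunc)"
  using trunc_map_abs[of 1] by (simp add: integral_hom_one abs_trunc_one integers_closed)

lemma trunc_map_zero: "trunc_map h (0 :: ('a, 'n::finite) trunc) = (0 :: ('b, 'n) trunc)"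
  using trunc_map_abs[of 0] by (simp add: integral_hom_zero abs_trunc_zero integers_closed)

lemma trunc_map_minus: "trunc_map h (- a) = (- trunc_map h a :: ('b, 'n::finite) trunc)"
  for a :: "('a, 'n::finite) trunc"
  using trunc_map_add[of a "- a"] by (simp add: trunc_map_zero add_eq_0_iff)

lemma trunc_map_diff: "trunc_map h (a - b) = (trunc_map h a - trunc_map h b :: ('b, 'n::finite) trunc)"
  for a b :: "('a, 'n::finite) trunc"
  using trunc_map_add[of a "- b"] by (simp add: trunc_map_minus)

lemma trunc_map_power: "trunc_map h (a ^ k) = (trunc_map h a ^ k :: ('b, 'n::finite) trunc)"
  for a :: "('a, 'n::finite) trunc"
  by (induction k) (simp_all add: trunc_map_one trunc_map_mult)

end


section \<open>Unramified quadratic extensions\<close>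

locale unramified_galois =
  fixes emb :: "'f::nonarch_local_field \<Rightarrow> 'e::nonarch_local_field" and \<sigma> :: "'e \<Rightarrow> 'e"
  assumes emb: "unramified_quadratic_ext emb" and gal: "nontrivial_galois emb \<sigma>"
begin

lemma emb_add: "emb (x + y) = emb x + emb y" and emb_mult: "emb (x * y) = emb x * emb y"
  and emb_one: "emb 1 = 1" and val_emb: "x \<noteq> 0 \<Longrightarrow> val (emb x) = val x"
  and dim_emb: "vector_space.dim (\<lambda>a z. emb a * z) (UNIV :: 'e set) = 2"
  using emb by (auto simp: unramified_quadratic_ext_def)

lemma emb_zero: "emb 0 = 0"
  using emb_add[of 0 0] by (metis add_0 add_cancel_right_right)

lemma emb_diff: "emb (x - y) = emb x - emb y"
  using emb_add[of "x - y" y] by simp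

lemma emb_eq_0_iff: "emb x = 0 \<longleftrightarrow> x = 0"
  using emb_mult[of x "inverse x"] emb_one emb_zero by (cases "x = 0") auto

lemma emb_divide: "emb (x / y) = emb x / emb y"
proof (cases "y = 0")
  case False
  then show ?thesis using emb_mult[of "x / y" y] by (simp add: emb_eq_0_iff)
qed (simp add: emb_zero)

lemma val_ge_emb: "val_ge k (emb x) \<longleftrightarrow> val_ge k x"
  by (cases "x = 0") (simp_all add: val_ge_def emb_eq_0_iff val_emb)

lemma integral_hom_emb: "integral_hom emb"
  by (simp add: integral_hom_def emb_add emb_mult emb_one val_ge_emb)

lemma sigma_add: "\<sigma> (x + y) = \<sigma> x + \<sigma> y" and sigma_mult: "\<sigma> (x * y) = \<sigma> x * \<sigma> y"
  and sigma_emb: "\<sigma> (emb a) = emb a" and sigma_nontrivial: "\<sigma> \<noteq> id"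
  using gal by (auto simp: nontrivial_galois_def)

text \<open>
  An element outside the smaller field is independent of 1, and there is only room for two
  independent elements.
\<close>

lemma quadratic_basis:
  assumes w: "w \<notin> range emb"
  obtains a b where "z = emb a + emb b * w"
proof -
  interpret E: vector_space "\<lambda>a z. emb a * z"
    by unfold_locales (simp_all add: emb_add emb_mult emb_one algebra_simps)
  have span1: "E.span {1} = range emb"
    by (simp add: E.span_singleton)
  have ind: "E.independent {w, 1}"
    using w E.independent_insert[of w "{1}"] span1 by (simp add: E.dependent_single)
  obtain B where B: "E.independent B" "UNIV \<subseteq> E.span B" "card B = E.dim UNIV"
    by (rule E.basis_exists) 
  have cardB: "card B = 2" using B dim_emb by simp
  then have finB: "finite B" by (metis card.infinite zero_neq_numeral)
  have "w \<noteq> 1" using w emb_one by (metis rangeI)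
  have z: "z \<in> E.span {w, 1}"
  proof (rule ccontr)
    assume nz: "z \<notin> E.span {w, 1}"
    then have ind3: "E.independent {z, w, 1}" using ind by (simp add: E.independent_insert)
    have "card {z, w, 1} = 3"
      using \<open>w \<noteq> 1\<close> nz E.span_base[of _ "{w, 1}"] by (auto simp: card_insert_if)
    moreover have "card {z, w, 1} \<le> card B"
      using E.independent_span_bound[OF finB ind3] B(2) by blast
    ultimately show False using cardB by simp
  qed
  then obtain b where "z - emb b * w \<in> E.span {1}"
    using E.span_breakdown_eq by blast
  then obtain a where "z - emb b * w = emb a" using span1 by blast
  then have "z = emb a + emb b * w" by (simp add: algebra_simps)
  then show ?thesis using that by blast
qed

text \<open>
  An element moved by \<open>\<sigma>\<close> satisfies a quadratic equation over the smaller field, and its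
  conjugate is the other root; this gives \<open>\<sigma>\<close> explicitly in the basis \<open>1, w\<close>.
\<close>

lemma quadratic_generator:
  obtains w t n where "w \<notin> range emb" "\<sigma> w = emb t - w" "w * w = emb t * w - emb n"
proof -
  obtain w where w: "\<sigma> w \<noteq> w" using sigma_nontrivial by (auto simp: fun_eq_iff)
  then have nw: "w \<notin> range emb" using sigma_emb by auto
  obtain a b where ab: "w * w = emb a + emb b * w" using quadratic_basis[OF nw] by metis
  then have "\<sigma> w * \<sigma> w = emb a + emb b * \<sigma> w"
    using sigma_mult sigma_add sigma_emb by metis
  then have "(\<sigma> w - w) * (\<sigma> w + w - emb b) = 0" using ab by (simp add: algebra_simps)
  then have "\<sigma> w + w - emb b = 0" using w by (metis mult_eq_0_iff eq_iff_diff_eq_0)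
  then have "\<sigma> w = emb b - w" by (simp add: algebra_simps)
  moreover have "w * w = emb b * w - emb (0 - a)" using ab by (simp only: emb_diff emb_zero) simp
  ultimately show ?thesis using that nw by blast
qed

lemma trace_norm_in_base:
  obtains t n where "z + \<sigma> z = emb t" "z * \<sigma> z = emb n"
proof -
  obtain w t n where w: "w \<notin> range emb" "\<sigma> w = emb t - w" "w * w = emb t * w - emb n"
    by (rule quadratic_generator)
  obtain a b where z: "z = emb a + emb b * w" using quadratic_basis[OF w(1)] by metis
  then have sz: "\<sigma> z = emb a + emb b * (emb t - w)" using sigma_add sigma_mult sigma_emb w(2) by metis
  have "z + \<sigma> z = emb (a + a + b * t)"
    by (subst sz, subst z, simp only: emb_add emb_mult) (simp add: algebra_simps)
  moreover have "z * \<sigma> z = emb a * emb a + emb a * emb b * emb t + emb b * emb b * (emb t * w - w * w)"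
    by (subst sz, subst z) (simp add: algebra_simps)
  then have "z * \<sigma> z = emb (a * a + a * b * t + b * b * n)"
    unfolding w(3) by (simp add: emb_add emb_mult)
  ultimately show ?thesis using that by blast
qed

text \<open>
  The instance of Hensel's lemma needed here: the small root of \<open>X\<^sup>2 - X + c\<close>.  The map
  \<open>x \<mapsto> x\<^sup>2 + c\<close> is contracting on the maximal ideal, so its iterates, which start in the
  smaller field, converge to \<open>w\<close>; as the smaller field is complete, it contains the limit.
\<close>

lemma hensel_root:
  assumes w: "w = w * w + emb c" and vw: "val_ge 1 w"
  shows "w \<in> range emb"
proof -
  have vc: "val_ge 1 c"
  proof -
    have "val_ge 1 (w * w)" using val_ge_mult_integral[of w 1 w] vw val_ge_mono[OF vw, of 0] by simp
    then have "val_ge 1 (w - w * w)" using vw val_ge_diff by blast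
    moreover have "w - w * w = emb c" using w by (metis add_diff_cancel_left')
    ultimately show ?thesis using val_ge_emb by metis
  qed
  define s where "s = rec_nat 0 (\<lambda>_ x. x * x + c)"
  have s0: "s 0 = 0" and sS: "\<And>n. s (Suc n) = s n * s n + c" by (simp_all add: s_def)
  have sv: "val_ge 1 (s n)" for n
  proof (induction n)
    case (Suc n)
    then have "val_ge 1 (s n * s n)" using val_ge_mult_integral[of "s n" 1 "s n"] val_ge_mono[of 1 "s n" 0] by simp
    then show ?case using vc val_ge_add by (simp add: sS)
  qed (simp add: s0)
  have conv: "val_ge (int n + 1) (emb (s n) - w)" for n
  proof (induction n)
    case 0
    then show ?case using vw by (simp add: s0 emb_zero)
  next
    case (Suc n)
    have "emb (s (Suc n)) - w = (emb (s n) * emb (s n) + emb c) - (w * w + emb c)"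
      using w by (simp add: sS emb_add emb_mult)
    also have "\<dots> = (emb (s n) - w) * (emb (s n) + w)" by (simp add: algebra_simps)
    finally have eq: "emb (s (Suc n)) - w = (emb (s n) - w) * (emb (s n) + w)" .
    have "val_ge 1 (emb (s n) + w)" using sv vw by (simp add: val_ge_add val_ge_emb)
    from val_ge_mult[OF Suc this] show ?case unfolding eq by simp
  qed
  have close: "val_ge k (emb (s n) - w)" if "nat k \<le> n" for k n
    using conv[of n] by (rule val_ge_mono) (use that in linarith)
  have "val_Cauchy s"
    unfolding val_Cauchy_def
  proof (intro allI exI impI)
    fix k m n assume "nat k \<le> m" "nat k \<le> n"
    then have "val_ge k ((emb (s m) - w) - (emb (s n) - w))" by (intro val_ge_diff close)
    then show "val_ge k (s m - s n)" using val_ge_emb[of k "s m - s n"] by (simp add: emb_diff)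
  qed
  then obtain L where L: "val_tendsto s L" using val_complete by blast
  have "val_ge (int k) (emb L - w)" for k
  proof -
    obtain M where M: "\<And>n. n \<ge> M \<Longrightarrow> val_ge (int k) (s n - L)" using L unfolding val_tendsto_def by blast
    define n where "n = max M k"
    have "val_ge (int k) (emb (s n) - w)" by (rule close) (simp add: n_def)
    moreover have "val_ge (int k) (emb (s n) - emb L)" using M[of n] val_ge_emb by (simp add: n_def emb_diff[symmetric])
    ultimately have "val_ge (int k) ((emb (s n) - w) - (emb (s n) - emb L))" by (rule val_ge_diff)
    then show ?thesis by simp
  qed
  then have "emb L - w = 0" by (rule eq_0_if_val_ge)
  then show ?thesis by (metis eq_iff_diff_eq_0 rangeI)
qed

text \<open>
  If \<open>z\<close> is integral and \<open>\<sigma> z\<close> is not, then the trace \<open>t\<close> of \<open>z\<close>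
  is not integral either, and \<open>z / t\<close> is the small root of \<open>X\<^sup>2 - X + n / t\<^sup>2\<close>, where
  \<open>n\<close> is the norm.  It therefore lies in the smaller field, and \<open>\<sigma>\<close> fixes \<open>z\<close>.
\<close>

lemma sigma_integral:
  assumes z: "val_ge 0 z" shows "val_ge 0 (\<sigma> z)"
proof (rule ccontr)
  assume nz: "\<not> val_ge 0 (\<sigma> z)"
  obtain t n where tn: "z + \<sigma> z = emb t" "z * \<sigma> z = emb n" by (rule trace_norm_in_base)
  have nt: "\<not> val_ge 0 (emb t)"
  proof
    assume "val_ge 0 (emb t)"
    then have "val_ge 0 (emb t - z)" using z val_ge_diff by blast
    then show False using nz tn(1) by (metis add_diff_cancel_left')
  qed
  then have t: "emb t \<noteq> 0" "val (emb t) < 0" by (auto simp: val_ge_def)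
  define w where "w = z / emb t"
  have zw: "z = w * emb t" using t by (simp add: w_def)
  have sz: "\<sigma> z = emb t - z" using tn(1) by (simp add: algebra_simps)
  have "val_ge 1 w"
  proof (cases "w = 0")
    case False
    then have "val z = val w + val (emb t)" unfolding zw using t(1) by (rule val_mult)
    moreover have "0 \<le> val z" using z False zw t(1) by (auto simp: val_ge_def)
    ultimately show ?thesis using t by (simp add: val_ge_def)
  qed simp
  moreover have "w = w * w + emb (n / (t * t))"
  proof -
    have "emb (n / (t * t)) = (z * (emb t - z)) / (emb t * emb t)"
      using tn(2) sz by (simp add: emb_divide emb_mult)
    also have "\<dots> = w - w * w" unfolding w_def using t(1) by (simp add: field_simps)
    finally show ?thesis by simp
  qed
  ultimately have "w \<in> range emb" using hensel_root by blast
  then obtain v where "z = emb (v * t)" using zw emb_mult by auto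
  then have "\<sigma> z = z" using sigma_emb by metis
  then show False using nz z by simp
qed

text \<open>
  The smaller field contains a uniformizer of the larger one, as the extension is unramified, so
  preserving the integers is enough.
\<close>

lemma integral_hom_sigma: "integral_hom \<sigma>"
proof -
  obtain \<pi> :: 'f where \<pi>: "uniformizer \<pi>" using val_normalised by (auto simp: uniformizer_def)
  have \<pi>E: "uniformizer (emb \<pi>)" using \<pi> by (simp add: uniformizer_def emb_eq_0_iff val_emb)
  have s1: "\<sigma> 1 = 1" using sigma_emb[of 1] by (simp add: emb_one)
  have pow: "\<sigma> (emb \<pi> ^ n) = emb \<pi> ^ n" for n
    by (induction n) (simp_all add: s1 sigma_mult sigma_emb)
  have "val_ge (int n) (\<sigma> x)" if x: "val_ge (int n) x" for n x
  proof -
    obtain y where y: "val_ge 0 y" "x = emb \<pi> ^ n * y" using val_ge_iff_uniformizer[OF \<pi>E] x by blast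
    then have "\<sigma> x = emb \<pi> ^ n * \<sigma> y" by (simp add: sigma_mult pow)
    then show ?thesis using val_ge_iff_uniformizer[OF \<pi>E] sigma_integral[OF y(1)] by blast
  qed
  then show ?thesis by (simp add: integral_hom_def sigma_add sigma_mult s1)
qed

lemma inj_trunc_emb: "inj (trunc_map emb :: ('f, 'n::finite) trunc \<Rightarrow> ('e, 'n) trunc)"
proof (rule injI)
  fix a b :: "('f, 'n) trunc"
  assume eq: "(trunc_map emb a :: ('e, 'n) trunc) = trunc_map emb b"
  obtain x y where x: "x \<in> integers" "a = abs_trunc x" and y: "y \<in> integers" "b = abs_trunc y"
    by (metis trunc_cases)
  have "(abs_trunc (emb x) :: ('e, 'n) trunc) = abs_trunc (emb y)"
    using eq x y by (simp add: trunc_map_abs[OF integral_hom_emb])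
  then have "val_ge (int CARD('n)) (emb (x - y))"
    using abs_trunc_eq_iff[of "emb x" "emb y", where 'n = 'n] x y
    by (simp add: integral_hom_integer[OF integral_hom_emb] emb_diff)
  then show "a = b" using abs_trunc_eq_iff[of x y, where 'n = 'n] x y val_ge_emb by simp
qed

lemma trunc_descend_emb: "trunc_descend emb (trunc_map emb a) = a"
  for a :: "('f, 'n::finite) trunc"
  unfolding trunc_descend_def by (rule inv_f_f[OF inj_trunc_emb])

lemma trunc_sigma_emb: "trunc_map \<sigma> (trunc_map emb a :: ('e, 'n::finite) trunc) = (trunc_map emb a :: ('e, 'n) trunc)"
  for a :: "('f, 'n::finite) trunc"
proof -
  obtain x where "x \<in> integers" "a = abs_trunc x" by (rule trunc_cases)
  then show ?thesis
    by (simp add: trunc_map_abs[OF integral_hom_emb] trunc_map_abs[OF integral_hom_sigma]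
        integral_hom_integer[OF integral_hom_emb] sigma_emb)
qed

lemma emb_integer_iff: "emb x \<in> integers \<longleftrightarrow> x \<in> integers"
  by (simp add: integers_def val_ge_emb)

lemma trunc_emb_ext_Tr: "trunc_map emb (ext_Tr emb \<sigma> z) = z + trunc_map \<sigma> z"
  for z :: "('e, 'n::finite) trunc"
proof -
  obtain x where x: "x \<in> integers" "z = abs_trunc x" by (rule trunc_cases)
  have sx: "\<sigma> x \<in> integers" using x integral_hom_integer[OF integral_hom_sigma] by blast
  obtain t n where t: "x + \<sigma> x = emb t" by (rule trace_norm_in_base)
  have "t \<in> integers" using t x sx integers_closed(1) emb_integer_iff by metis
  then have "z + trunc_map \<sigma> z = trunc_map emb (abs_trunc t :: ('f, 'n) trunc)"
    using x sx t by (simp add: trunc_map_abs[OF integral_hom_emb] trunc_map_abs[OF integral_hom_sigma] abs_trunc_add[symmetric])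
  then show ?thesis unfolding ext_Tr_def by (simp add: trunc_descend_emb)
qed

lemma trunc_emb_ext_N: "trunc_map emb (ext_N emb \<sigma> z) = z * trunc_map \<sigma> z"
  for z :: "('e, 'n::finite) trunc"
proof -
  obtain x where x: "x \<in> integers" "z = abs_trunc x" by (rule trunc_cases)
  have sx: "\<sigma> x \<in> integers" using x integral_hom_integer[OF integral_hom_sigma] by blast
  obtain t n where t: "x * \<sigma> x = emb n" by (rule trace_norm_in_base)
  have "n \<in> integers" using t x sx integers_closed(3) emb_integer_iff by metis
  then have "z * trunc_map \<sigma> z = trunc_map emb (abs_trunc n :: ('f, 'n) trunc)"
    using x sx t by (simp add: trunc_map_abs[OF integral_hom_emb] trunc_map_abs[OF integral_hom_sigma] abs_trunc_mult[symmetric])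
  then show ?thesis unfolding ext_N_def by (simp add: trunc_descend_emb)
qed

lemma trunc_emb_unit:
  fixes a :: "('f, 'n::finite) trunc"
  assumes "a dvd 1" shows "(trunc_map emb a :: ('e, 'n) trunc) dvd 1"
proof -
  let ?e = "trunc_map emb :: ('f, 'n) trunc \<Rightarrow> ('e, 'n) trunc"
  obtain u where u: "1 = a * u" using assms by (rule dvdE)
  have "?e a * ?e u = ?e (a * u)" by (rule trunc_map_mult[OF integral_hom_emb, symmetric])
  also have "\<dots> = 1" unfolding u[symmetric] by (rule trunc_map_one[OF integral_hom_emb])
  finally show ?thesis by (metis dvd_triv_left)
qed

text \<open>
  The trace of \<open>t\<close> is fixed by \<open>\<sigma>\<close>, so that \<open>\<sigma>\<close> exchanges its two summands.
\<close>

lemma trunc_sigma_conjugate: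
  fixes t :: "('e, 'n::finite) trunc"
  shows "trunc_map \<sigma> (trunc_map \<sigma> t :: ('e, 'n) trunc) = t"
proof -
  let ?s = "trunc_map \<sigma> :: ('e, 'n) trunc \<Rightarrow> ('e, 'n) trunc"
  let ?tr = "trunc_map emb (ext_Tr emb \<sigma> t :: ('f, 'n) trunc) :: ('e, 'n) trunc"
  have tr: "?tr = t + ?s t" by (rule trunc_emb_ext_Tr)
  have "?s (t + ?s t) = ?s t + ?s (?s t)" by (rule trunc_map_add[OF integral_hom_sigma])
  moreover have "?s (t + ?s t) = t + ?s t" unfolding tr[symmetric] by (rule trunc_sigma_emb)
  ultimately have "t + ?s t = ?s t + ?s (?s t)" by simp
  then show ?thesis by (simp add: add.commute)
qed

lemma uniformizer_emb: "uniformizer \<pi> \<Longrightarrow> uniformizer (emb \<pi>)"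
  by (simp add: uniformizer_def emb_eq_0_iff val_emb)

lemma trunc_emb_uniformizer:
  "uniformizer \<pi> \<Longrightarrow> trunc_map emb (abs_trunc \<pi> :: ('f, 'n::finite) trunc) = (abs_trunc (emb \<pi>) :: ('e, 'n) trunc)"
  by (rule trunc_map_abs[OF integral_hom_emb uniformizer_integer])

lemma trunc_sigma_uniformizer:
  "uniformizer \<pi> \<Longrightarrow> trunc_map \<sigma> (abs_trunc (emb \<pi>) :: ('e, 'n::finite) trunc) = (abs_trunc (emb \<pi>) :: ('e, 'n) trunc)"
  using trunc_map_abs[OF integral_hom_sigma uniformizer_integer[OF uniformizer_emb]] by (simp add: sigma_emb)

text \<open>
  Over the larger field the form factors as \<open>(d - b t) (d - b \<sigma>(t))\<close>.  If the uniformizer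
  divides one factor, then it divides the other one, which is the conjugate, and hence the
  difference \<open>b (t - \<sigma>(t))\<close>.
\<close>

lemma charpoly_anisotropic:
  fixes t :: "('e, 'n::finite) trunc" and b d :: "('f, 'n) trunc"
  assumes \<pi>: "uniformizer \<pi>" and t: "t - trunc_map \<sigma> t dvd 1"
    and dvd: "abs_trunc \<pi> dvd d\<^sup>2 - ext_Tr emb \<sigma> t * b * d + ext_N emb \<sigma> t * b\<^sup>2"
  shows "abs_trunc \<pi> dvd b \<and> abs_trunc \<pi> dvd d"
proof -
  note hom = trunc_map_add[OF integral_hom_emb] trunc_map_mult[OF integral_hom_emb]
    trunc_map_diff[OF integral_hom_emb] trunc_map_power[OF integral_hom_emb]
  interpret F: finite_chain_ring "abs_trunc \<pi> :: ('f, 'n) trunc" "CARD('n)"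
    by (rule finite_chain_ring_trunc[OF \<pi>])
  interpret E: finite_chain_ring "abs_trunc (emb \<pi>) :: ('e, 'n) trunc" "CARD('n)"
    by (rule finite_chain_ring_trunc[OF uniformizer_emb[OF \<pi>]])
  let ?P = "abs_trunc (emb \<pi>) :: ('e, 'n) trunc"
  let ?e = "trunc_map emb :: ('f, 'n) trunc \<Rightarrow> ('e, 'n) trunc"
  let ?s = "trunc_map \<sigma> :: ('e, 'n) trunc \<Rightarrow> ('e, 'n) trunc"
  have P: "?e (abs_trunc \<pi>) = ?P" by (rule trunc_emb_uniformizer[OF \<pi>])
  have emb_dvd: "abs_trunc \<pi> dvd a" if "?P dvd ?e a" for a
    using that F.unit_iff E.unit_iff trunc_emb_unit by blast
  have sigma_dvd: "?P dvd ?s z" if Pz: "?P dvd z" for z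
  proof -
    obtain y where "z = ?P * y" using Pz by (rule dvdE)
    then have "?s z = ?s ?P * ?s y" by (simp only: trunc_map_mult[OF integral_hom_sigma])
    also have "?s ?P = ?P" by (rule trunc_sigma_uniformizer[OF \<pi>])
    finally show ?thesis by simp
  qed
  let ?x = "?e d - ?e b * t" and ?y = "?e d - ?e b * ?s t"
  have sx: "?s ?x = ?y" and sy: "?s ?y = ?x"
    by (simp_all only: trunc_map_diff[OF integral_hom_sigma] trunc_map_mult[OF integral_hom_sigma]
        trunc_sigma_emb trunc_sigma_conjugate)
  obtain c where c: "d\<^sup>2 - ext_Tr emb \<sigma> t * b * d + ext_N emb \<sigma> t * b\<^sup>2 = abs_trunc \<pi> * c"
    using dvd by (rule dvdE)
  have "?x * ?y = (?e d)\<^sup>2 - (t + ?s t) * ?e b * ?e d + (t * ?s t) * (?e b)\<^sup>2"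
    by (simp add: algebra_simps power2_eq_square)
  also have "\<dots> = ?e (abs_trunc \<pi> * c)"
    unfolding c[symmetric] by (simp only: hom trunc_emb_ext_Tr trunc_emb_ext_N)
  also have "\<dots> = ?P * ?e c" by (simp only: hom P)
  finally have "\<not> ?x * ?y dvd 1" using E.unit_iff by simp
  then have "?P dvd ?x \<or> ?P dvd ?y" using E.unit_iff unit_mult by blast
  then have xy: "?P dvd ?x" "?P dvd ?y" using sigma_dvd[of ?x] sigma_dvd[of ?y] sx sy by auto
  have "?P dvd ?y - ?x" by (rule dvd_diff[OF xy(2,1)])
  then have "?P dvd ?e b * (t - ?s t)" by (simp add: algebra_simps)
  then have eb: "?P dvd ?e b" using t E.unit_iff unit_mult by blast
  then have "?P dvd ?x + ?e b * t" using xy by (intro dvd_add dvd_mult2)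
  then have "?P dvd ?e d" by simp
  then show ?thesis using emb_dvd eb by blast
qed

end

section \<open>Characters of truncations and regular couples\<close>

text \<open>
  Two integers with the same class differ by an element on which \<open>\<psi>\<close> is trivial.
\<close>

lemma trunc_character_abs:
  fixes x :: "'f::discrete_valued_field"
  assumes \<psi>: "additive_character_of_level CARD('n::finite) \<psi>" and x: "x \<in> integers"
  shows "trunc_character \<psi> (abs_trunc x :: ('f, 'n) trunc) = \<psi> x"
proof -
  let ?y = "rep_trunc (abs_trunc x :: ('f, 'n) trunc)"
  have y: "?y \<in> integers" by (rule rep_trunc_integer)
  have "val_ge (int CARD('n)) (?y - x)"
    using abs_trunc_eq_iff[OF y x, where 'n = 'n] by (simp add: abs_rep_trunc)
  then have "\<psi> (?y - x) = 1" using \<psi> by (simp add: additive_character_of_level_def)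
  moreover have "\<psi> (x + (?y - x)) = \<psi> x * \<psi> (?y - x)"
    using \<psi> x integers_closed(2)[OF y x] unfolding additive_character_of_level_def by blast
  ultimately show ?thesis by (simp add: trunc_character_def)
qed

lemma trunc_character_props:
  fixes \<psi> :: "'f::discrete_valued_field \<Rightarrow> complex"
  assumes \<psi>: "additive_character_of_level CARD('n::finite) \<psi>"
  shows "trunc_character \<psi> (a + b :: ('f, 'n) trunc) = trunc_character \<psi> a * trunc_character \<psi> b"
    and "trunc_character \<psi> (0 :: ('f, 'n) trunc) = 1"
    and "uniformizer \<pi> \<Longrightarrow> \<exists>a :: ('f, 'n) trunc. trunc_character \<psi> (abs_trunc \<pi> ^ (CARD('n) - 1) * a) \<noteq> 1"
proof -
  obtain x y where xy: "x \<in> integers" "a = abs_trunc x" "y \<in> integers" "b = abs_trunc y"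
    by (metis trunc_cases)
  have "\<psi> (x + y) = \<psi> x * \<psi> y" using \<psi> xy unfolding additive_character_of_level_def by blast
  then show "trunc_character \<psi> (a + b) = trunc_character \<psi> a * trunc_character \<psi> b"
    using trunc_character_abs[OF \<psi>] xy integers_closed(1)[OF xy(1,3)] abs_trunc_add[OF xy(1,3), where 'b = 'n]
    by metis
  have "\<psi> 0 = 1" using \<psi> by (simp add: additive_character_of_level_def)
  then show "trunc_character \<psi> (0 :: ('f, 'n) trunc) = 1"
    using trunc_character_abs[OF \<psi> integers_closed(5)] by (simp add: abs_trunc_zero)
  assume \<pi>: "uniformizer \<pi>"
  have n: "int CARD('n) - 1 = int (CARD('n) - 1)"
    using zero_less_card_finite[where 'a = 'n] by linarith
  obtain z where z: "val_ge (int CARD('n) - 1) z" "\<psi> z \<noteq> 1"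
    using \<psi> unfolding additive_character_of_level_def by blast
  then obtain w where w: "val_ge 0 w" "z = \<pi> ^ (CARD('n) - 1) * w"
    using val_ge_iff_uniformizer[OF \<pi>] unfolding n by blast
  have wi: "w \<in> integers" using w by (simp add: integers_def)
  have pi: "\<pi> ^ (CARD('n) - 1) \<in> integers" using uniformizer_integer[OF \<pi>] integers_closed(4) by blast
  have "trunc_character \<psi> (abs_trunc z :: ('f, 'n) trunc) \<noteq> 1"
    using trunc_character_abs[OF \<psi>, of z] z w(2) integers_closed(3)[OF pi wi] by simp
  moreover have "(abs_trunc z :: ('f, 'n) trunc) = abs_trunc \<pi> ^ (CARD('n) - 1) * abs_trunc w"
    using abs_trunc_mult[OF pi wi] abs_trunc_power[OF uniformizer_integer[OF \<pi>]] w(2) by metis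
  ultimately show "\<exists>a :: ('f, 'n) trunc. trunc_character \<psi> (abs_trunc \<pi> ^ (CARD('n) - 1) * a) \<noteq> 1"
    by metis
qed

lemma unit_character_one: "unit_character \<nu> \<Longrightarrow> \<nu> 1 = 1"
  unfolding unit_character_def by (metis dvd_refl mult_1_right mult_cancel_left)

lemma unit_character_mult: "unit_character \<nu> \<Longrightarrow> x dvd 1 \<Longrightarrow> y dvd 1 \<Longrightarrow> \<nu> (x * y) = \<nu> x * \<nu> y"
  unfolding unit_character_def by blast

text \<open>
  On an element \<open>u = 1 + \<pi>\<^sup>r\<^sup>-\<^sup>1 z\<close> with \<open>\<sigma>(z) = - z\<close> the conjugate
  \<open>\<sigma>(u)\<close> is the inverse of \<open>u\<close>.  The quotient of the two characters at \<open>u\<close> is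
  thus the value of \<open>\<psi>\<close> at the class of \<open>\<pi>\<^sup>r\<^sup>-\<^sup>1 (t - \<sigma>(t)) z\<close>, which would be 1
  if \<open>t - \<sigma>(t)\<close> were divisible by the uniformizer.
\<close>

lemma (in unramified_galois) regular_parameter_unit:
  fixes \<nu> \<nu>' :: "('e, 'r::finite) trunc \<Rightarrow> complex" and t :: "('e, 'r) trunc"
  assumes r: "CARD('r) = 2 * CARD('l::finite)"
    and \<pi>: "uniformizer \<pi>"
    and \<psi>: "additive_character_of_level CARD('r) \<psi>"
    and \<nu>': "unit_character \<nu>'"
    and reg: "regular_couple (emb \<pi>) \<sigma> \<nu> \<nu>'"
    and par: "\<And>z. \<nu> (1 + abs_trunc (emb \<pi>) ^ CARD('l) * z) * \<nu>' (1 + abs_trunc (emb \<pi>) ^ CARD('l) * trunc_map \<sigma> z) =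
        trunc_character \<psi> (trunc_descend emb
          (abs_trunc (emb \<pi>) ^ CARD('l) * (t * z + trunc_map \<sigma> t * trunc_map \<sigma> z)))"
  shows "t - trunc_map \<sigma> t dvd 1"
proof (rule ccontr)
  let ?P = "abs_trunc (emb \<pi>) :: ('e, 'r) trunc"
  let ?r = "CARD('r)" and ?l = "CARD('l)"
  interpret E: finite_chain_ring ?P ?r
    by (rule finite_chain_ring_trunc[OF uniformizer_emb[OF \<pi>]])
  have l: "0 < ?l" by simp
  assume "\<not> t - trunc_map \<sigma> t dvd 1"
  then obtain y where y: "t - trunc_map \<sigma> t = ?P * y" using E.unit_or_dvd by (metis dvdE)
  obtain z where sz: "trunc_map \<sigma> z = - z"
    and z: "\<nu> (1 + ?P ^ (?r - 1) * z) * inverse (\<nu>' (1 + ?P ^ (?r - 1) * z)) \<noteq> 1"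
    using reg unfolding regular_couple_def Let_def by blast
  let ?h = "?P ^ (?r - 1) * z"
  define z' where "z' = ?P ^ (?r - 1 - ?l) * z"
  have rl: "?l + (?r - 1 - ?l) = ?r - 1" using r l by linarith
  have "?P ^ ?l * ?P ^ (?r - 1 - ?l) = ?P ^ (?r - 1)" by (simp only: power_add[symmetric] rl)
  then have h: "?P ^ ?l * z' = ?h" unfolding z'_def by (simp only: mult.assoc[symmetric])
  have sP: "trunc_map \<sigma> ?P = ?P"
    by (rule trunc_sigma_uniformizer[OF \<pi>])
  have sz': "trunc_map \<sigma> z' = - z'"
    unfolding z'_def trunc_map_mult[OF integral_hom_sigma] trunc_map_power[OF integral_hom_sigma] sP sz by simp
  have P2: "?P ^ (?r - 1) * ?P ^ (?r - 1) = 0"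
    unfolding power_add[symmetric] by (rule E.p_pow_eq_0) (use r l in linarith)
  have "?h * ?h = (?P ^ (?r - 1) * ?P ^ (?r - 1)) * (z * z)" by (simp only: ac_simps)
  then have hh: "?h * ?h = 0" unfolding P2 by simp
  have inv: "(1 + ?h) * (1 - ?h) = 1" using hh by (simp add: algebra_simps)
  then have u: "1 + ?h dvd 1" "1 - ?h dvd 1" by (metis dvd_triv_left, metis dvd_triv_right)
  have "\<nu>' (1 + ?h) * \<nu>' (1 - ?h) = 1"
    using unit_character_mult[OF \<nu>' u] unit_character_one[OF \<nu>'] inv by simp
  then have "inverse (\<nu>' (1 + ?h)) = \<nu>' (1 - ?h)" by (rule inverse_unique)
  then have "\<nu> (1 + ?P ^ ?l * z') * \<nu>' (1 + ?P ^ ?l * trunc_map \<sigma> z') \<noteq> 1"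
    using z sz' h by simp
  moreover have "?P ^ ?l * (t * z' + trunc_map \<sigma> t * trunc_map \<sigma> z') = 0"
  proof -
    have "?P ^ ?l * (t * z' + trunc_map \<sigma> t * trunc_map \<sigma> z') = (t - trunc_map \<sigma> t) * (?P ^ ?l * z')"
      by (simp add: sz' algebra_simps)
    also have "\<dots> = (?P ^ (?r - 1) * ?P) * (y * z)"
      unfolding y h by (simp add: ac_simps)
    also have "?P ^ (?r - 1) * ?P = 0"
      unfolding power_Suc2[symmetric] by (rule E.p_pow_eq_0) simp
    finally show ?thesis by simp
  qed
  ultimately show False
    using par[of z'] trunc_descend_emb[of "0 :: ('f, 'r) trunc"] trunc_map_zero[OF integral_hom_emb, where 'n = 'r]
      trunc_character_props(2)[OF \<psi>] by metis
qed

section \<open>The character of a cuspidal representation\<close>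

theorem proposition13:
  fixes emb :: "'f::nonarch_local_field \<Rightarrow> 'e::nonarch_local_field"
    and \<sigma> :: "'e \<Rightarrow> 'e"
    and \<psi> :: "'f \<Rightarrow> complex"
    and \<pi> :: 'f
    and \<nu> \<nu>' :: "('e, 'r::finite) trunc \<Rightarrow> complex"
    and \<tau> :: "('e, 'l::finite) trunc"
    and \<tau>h :: "('e, 'r) trunc"
    and i :: nat
    and \<alpha> \<beta> :: "('f, 'r) trunc"
  assumes "CARD('r) = 2 * CARD('l)"
    and "CHAR(('f, 1) trunc) \<noteq> 2"
    and "uniformizer \<pi>"
    and "additive_character_of_level CARD('r) \<psi>"
    and "unramified_quadratic_ext emb"
    and "nontrivial_galois emb \<sigma>"
    and "unit_character \<nu>" and "unit_character \<nu>'"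
    and "regular_couple (emb \<pi>) \<sigma> \<nu> \<nu>'"
    and "associated_parameter emb \<sigma> \<psi> (emb \<pi>) \<nu> \<nu>' \<tau>"
    and "reduction \<tau>h = \<tau>"
    and "i \<le> CARD('r) - 1"
    and "\<alpha> dvd 1"
  shows "cuspidal_character emb \<sigma> \<psi> \<pi> \<nu> \<nu>' \<tau>h
      (mat2 \<alpha> (abs_trunc \<pi> ^ (i + 1) * \<beta>) (abs_trunc \<pi> ^ i) \<alpha>) =
    - (of_bool (i = CARD('r) - 1) * \<nu> (trunc_emb emb \<alpha>) * \<nu>' (trunc_emb emb \<alpha>) *
        of_nat CARD(('f, 1) trunc) ^ (CARD('r) - 1))"
proof -
  note r = assms(1) and \<pi> = assms(3) and \<psi> = assms(4) and \<nu> = assms(7) and \<nu>' = assms(8)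
  interpret ug: unramified_galois emb \<sigma> using assms(5,6) by unfold_locales
  let ?e = "trunc_map emb :: ('f, 'r) trunc \<Rightarrow> ('e, 'r) trunc"
  let ?s = "trunc_map \<sigma> :: ('e, 'r) trunc \<Rightarrow> ('e, 'r) trunc"
  let ?p = "abs_trunc \<pi> :: ('f, 'r) trunc" and ?P = "abs_trunc (emb \<pi>) :: ('e, 'r) trunc"
  define tr nm where "tr = ext_Tr emb \<sigma> \<tau>h" and "nm = ext_N emb \<sigma> \<tau>h"
  define \<theta> where "\<theta> a b = \<nu> (?e a + ?e b * \<tau>h) * \<nu>' (?e a + ?e b * ?s \<tau>h)" for a b
  note hom = trunc_map_add[OF ug.integral_hom_emb] trunc_map_mult[OF ug.integral_hom_emb]
    trunc_map_diff[OF ug.integral_hom_emb] trunc_map_power[OF ug.integral_hom_emb]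
    trunc_map_one[OF ug.integral_hom_emb] trunc_map_zero[OF ug.integral_hom_emb]
  have tr: "?e tr = \<tau>h + ?s \<tau>h" and nm: "?e nm = \<tau>h * ?s \<tau>h"
    unfolding tr_def nm_def by (rule ug.trunc_emb_ext_Tr, rule ug.trunc_emb_ext_N)
  have P: "?e ?p = ?P" by (rule ug.trunc_emb_uniformizer[OF \<pi>])
  have par: "\<nu> (1 + ?P ^ CARD('l) * z) * \<nu>' (1 + ?P ^ CARD('l) * ?s z) =
      trunc_character \<psi> (trunc_descend emb (?P ^ CARD('l) * (\<tau>h * z + ?s \<tau>h * ?s z)))" for z
    using assms(10,11) unfolding associated_parameter_def by blast
  have unit: "\<tau>h - ?s \<tau>h dvd 1"
    by (rule ug.regular_parameter_unit[OF r \<pi> \<psi> \<nu>' assms(9) par])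
  interpret chain: finite_chain_ring ?p "CARD('r)" by (rule finite_chain_ring_trunc[OF \<pi>])
  interpret ell: elliptic_matrix ?p "CARD('r)" tr nm
  proof
    fix b d assume "?p dvd d\<^sup>2 - tr * b * d + nm * b\<^sup>2"
    then show "?p dvd b \<and> ?p dvd d"
      unfolding tr_def nm_def by (rule ug.charpoly_anisotropic[OF \<pi> unit])
  qed
  have lin_unit: "?e a + ?e b * \<tau>h dvd 1" "?e a + ?e b * ?s \<tau>h dvd 1" if "ell.lin a b \<in> GL" for a b
  proof -
    have "det (ell.lin a b) dvd 1" using that GL_2_iff by blast
    then have "?e (det (ell.lin a b)) dvd 1" by (rule ug.trunc_emb_unit)
    also have "det (ell.lin a b) = a * a + tr * (a * b) + nm * (b * b)"
      by (simp add: det_2 algebra_simps)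
    also have "?e \<dots> = (?e a + ?e b * \<tau>h) * (?e a + ?e b * ?s \<tau>h)"
      unfolding hom tr nm by (simp add: algebra_simps)
    finally show "?e a + ?e b * \<tau>h dvd 1" "?e a + ?e b * ?s \<tau>h dvd 1"
      by (blast dest: dvd_mult_left dvd_mult_right)+
  qed
  interpret box: box_datum ?p "CARD('r)" tr nm "CARD('l)" "trunc_character \<psi>" \<theta>
  proof
    show "CARD('r) = 2 * CARD('l)" by (rule r)
    show "trunc_character \<psi> (x + y) = trunc_character \<psi> x * trunc_character \<psi> y" for x y :: "('f, 'r) trunc"
      by (rule trunc_character_props(1)[OF \<psi>])
    show "trunc_character \<psi> (0 :: ('f, 'r) trunc) = 1" by (rule trunc_character_props(2)[OF \<psi>])
    show "\<exists>x. trunc_character \<psi> (?p ^ (CARD('r) - 1) * x) \<noteq> 1" by (rule trunc_character_props(3)[OF \<psi> \<pi>])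
  next
    fix a b c d assume u: "ell.lin a b \<in> GL" "ell.lin c d \<in> GL"
    let ?A = "a * c - nm * b * d" and ?B = "a * d + b * c + tr * b * d"
    have "?e ?A + ?e ?B * \<tau>h = (?e a + ?e b * \<tau>h) * (?e c + ?e d * \<tau>h)"
      unfolding hom tr nm by (simp add: algebra_simps)
    moreover have "?e ?A + ?e ?B * ?s \<tau>h = (?e a + ?e b * ?s \<tau>h) * (?e c + ?e d * ?s \<tau>h)"
      unfolding hom tr nm by (simp add: algebra_simps)
    ultimately show "\<theta> ?A ?B = \<theta> a b * \<theta> c d"
      unfolding \<theta>_def using unit_character_mult[OF \<nu>] unit_character_mult[OF \<nu>'] lin_unit u by simp
  next
    fix a b :: "('f, 'r) trunc"
    let ?z = "?e a + ?e b * \<tau>h" and ?l = "CARD('l)"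
    let ?c = "?p ^ ?l * (a * tr + b * (tr * tr - nm - nm))"
    have sz: "?s ?z = ?e a + ?e b * ?s \<tau>h"
      by (simp only: trunc_map_add[OF ug.integral_hom_sigma] trunc_map_mult[OF ug.integral_hom_sigma] ug.trunc_sigma_emb)
    have "?P ^ ?l * (\<tau>h * ?z + ?s \<tau>h * ?s ?z) = ?e ?c"
      unfolding hom sz tr nm P by (simp add: algebra_simps)
    then have "\<nu> (1 + ?P ^ ?l * ?z) * \<nu>' (1 + ?P ^ ?l * ?s ?z) = trunc_character \<psi> ?c"
      using par[of ?z] by (simp add: ug.trunc_descend_emb)
    moreover have "?e (1 + ?p ^ ?l * a) + ?e (?p ^ ?l * b) * \<tau>h = 1 + ?P ^ ?l * ?z"
      "?e (1 + ?p ^ ?l * a) + ?e (?p ^ ?l * b) * ?s \<tau>h = 1 + ?P ^ ?l * ?s ?z"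
      unfolding hom sz P by (simp_all add: algebra_simps)
    moreover have "trace (ell.\<beta> ** (mat (?p ^ ?l) ** ell.lin a b)) = ?c"
      by (simp add: mat2_simps algebra_simps)
    ultimately show "\<theta> (1 + ?p ^ ?l * a) (?p ^ ?l * b) = trunc_character \<psi> (trace (ell.\<beta> ** (mat (?p ^ ?l) ** ell.lin a b)))"
      unfolding \<theta>_def by simp
  qed
  have l: "CARD('r) div 2 = CARD('l)" using r by simp
  have beta: "beta_hat emb \<sigma> \<tau>h = ell.\<beta>"
    by (simp only: beta_hat_def ell.\<beta>_def tr_def[symmetric] nm_def[symmetric])
  have "box_character emb \<sigma> \<psi> \<pi> \<nu> \<nu>' \<tau>h = box.box_char"
    unfolding fun_eq_iff box.box_char_def box.box_rel_def[abs_def] box_character_def beta l ell.lin_def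
    by (simp add: \<theta>_def)
  then have "cuspidal_character emb \<sigma> \<psi> \<pi> \<nu> \<nu>' \<tau>h = induced_character (group_T CARD('l) ?p ell.\<beta>) box.box_char"
    unfolding cuspidal_character_def beta l by simp
  moreover have "card {x. ?p dvd x} = CARD(('f, 1) trunc) ^ (CARD('r) - 1)"
    using chain.card_ideal[of 1] chain.r_pos card_residue_field[OF \<pi>, where 'r = 'r] by simp
  moreover have "\<theta> \<alpha> 0 = \<nu> (?e \<alpha>) * \<nu>' (?e \<alpha>)"
    by (simp add: \<theta>_def hom)
  ultimately show ?thesis
    using box.induced_character_value[OF assms(12,13), of \<beta>] by (simp add: mult.assoc)
qed

end
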